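(* Let $M$ be a length space satisfying the Heine-Borel property (closed bounded subsets are compact), and such that for any two points $x,y\in M$ there exists an admissible path $\gamma$ between $x$ and $y$ which realizes the distance between $x$ and $y$, i.e. $\ell(\gamma)=d(x,y)$. Then, for any $X,Y\in\mathrm{Ran}(M)$ and any weight $\omega$, there exists an MBS-path $\Gamma\colon[a,b]\to\mathrm{Ran}(M)$ between $X$ and $Y$ (i.e. $\Gamma(a)=X$, $\Gamma(b)=Y$) such that $\ell^\omega(\Gamma)=d^\omega(X,Y)$.
   Context: Length structures. A length structure on a topological space $T$ is a set $\mathcal{P}$ of continuous paths $\gamma\colon[a,b]\to T$ ($a\le b$ real), called admissible, and a map $\ell\colon\mathcal{P}\to\mathbb{R}_+$ such that: (1) for a continuous path $\gamma\colon[a,b]\to T$ and $c\in[a,b]$, $\gamma\in\mathcal{P}$ iff $\gamma|_{[a,c]}\in\mathcal{P}$ and $\gamma|_{[c,b]}\in\mathcal{P}$, and then $\ell(\gamma)=\ell(\gamma|_{[a,c]})+\ell(\gamma|_{[c,b]})$; (2) for every affine homeomorphism $\varphi\colon[c,d]\to[a,b]$, $\gamma\in\mathcal{P}$ iff $\gamma\circ\varphi\in\mathcal{P}$, and then $\ell(\gamma)=\ell(\gamma\circ\varphi)$; (3) for $\gamma\colon[a,b]\to T$ in $\mathcal{P}$, $t\mapsto\ell(\gamma|_{[a,t]})$ is continuous on $[a,b]$; (4) for $x\in T$ and $U$ a neighborhood of $x$, there is $\epsilon>0$ such that $\ell(\gamma)>\epsilon$ for every $\gamma\colon[a,b]\to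 T$ in $\mathcal{P}$ with $\gamma(a)=x$, $\gamma(b)\notin U$. Constant paths are understood to be admissible. The associated metric is $d^\ell(x,y)=\inf\{\ell(\gamma)\mid\gamma\in\mathcal{P},\ x,y\in\mathrm{Im}(\gamma)\}$. A length space is a (Hausdorff) space with a length structure such that $d^\ell$ is a distance inducing the topology; it is then regarded as a metric space with $d=d^\ell$. Weighted distance. $\mathrm{Ran}(M)$ is the set of non-empty finite subsets of $M$. A weight is a non-decreasing function $\omega\colon\{1,2,\dots\}\to[1,\infty)$ with $\omega(1)=1$. A surjective relation from $X$ to $Y$ ($X,Y\in\mathrm{Ran}(M)$) is a subset $R\subset X\times Y$ projecting onto $X$ and onto $Y$; $\ell^\omega(R)=\omega(\mathrm{card}(R))\sum_{(x,y)\in R}d(x,y)$. A combinatorial chain from $X$ to $Y$ consists of $X=X_0,\dots,X_k=Y$ in $\mathrm{Ran}(M)$ and surjective relations $R_j$ from $X_j$ to $X_{j+1}$; its $\omega$-length is $\sum_j\ell^\omega(R_j)$. $d^\omega(X,Y)$ is the infimum of the $\omega$-lengths of combinatorial chains from $X$ to $Y$. Paths in $\mathrm{Ran}(M)$. Let $\pi_n\colon M^n\to\mathrm{Ran}(M)$ send a tuple to its set of coordinates. A lift of a path $\Gamma\colon[a,b]\to\mathrm{Ran}(M)$ is a subdivision $a=t_0<\dots<t_k=b$ ($k\ge0$) together with continuous paths $\underline{\gamma_i}=(\gamma_i^{(1)},\dots,\gamma_i^{(n_i)})\colon[t_i,t_{i+1}]\to M^{n_i}$, $n_i\ge1$, $0\le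 i\le k-1$, with $\pi_{n_i}(\underline{\gamma_i}(t))=\Gamma(t)$ for all $t\in[t_i,t_{i+1}]$. The lift is admissible if every $\gamma_i^{(j)}$ is an admissible path of $M$. A path $\Gamma$ is admissible if it is continuous (automatic once a lift exists) and has an admissible lift. The length of an admissible lift is $\sum_{i=0}^{k-1}\omega(n_i)\sum_{j=1}^{n_i}\ell(\gamma_i^{(j)})$, and $\ell^\omega(\Gamma)$ is the infimum of the lengths of the admissible lifts of $\Gamma$. An admissible path $\Gamma\colon[a,b]\to\mathrm{Ran}(M)$ is crenelated if there is a subdivision $a=t_0<\dots<t_k=b$ such that $t\mapsto\mathrm{card}(\Gamma(t))$ is constant on each open interval $(t_i,t_{i+1})$. It is an MBS-path if it is crenelated and there is $c\in[a,b]$ such that $\mathrm{card}(\Gamma)$ is non-increasing on $[a,c]$ and non-decreasing on $[c,b]$. *)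

theory Defs
  imports "HOL-Analysis.Analysis"
begin

(* A path gamma : [a,b] -> T is encoded by a, b and a total function on the reals of which only the
   values on [a,b] matter; admissible_cong and length_cong enforce this. *)

locale length_structure =
  fixes adm :: "real \<Rightarrow> real \<Rightarrow> (real \<Rightarrow> 'a::topological_space) \<Rightarrow> bool"
    and len :: "real \<Rightarrow> real \<Rightarrow> (real \<Rightarrow> 'a) \<Rightarrow> real"
  assumes admissible_path: "adm a b \<gamma> \<Longrightarrow> a \<le> b \<and> continuous_on {a..b} \<gamma>"
    and admissible_cong: "adm a b \<gamma> \<Longrightarrow> (\<And>t. t \<in> {a..b} \<Longrightarrow> \<gamma> t = \<gamma>' t) \<Longrightarrow> adm a b \<gamma>'"
    and length_cong:
      "adm a b \<gamma> \<Longrightarrow> (\<And>t. t \<in> {a..b} \<Longrightarrow> \<gamma> t = \<gamma>' t) \<Longrightarrow> len a b \<gamma>' = len a b \<gamma>"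
    and length_nonneg: "adm a b \<gamma> \<Longrightarrow> 0 \<le> len a b \<gamma>"
    and admissible_split:
      "continuous_on {a..b} \<gamma> \<Longrightarrow> a \<le> c \<Longrightarrow> c \<le> b \<Longrightarrow> adm a b \<gamma> \<longleftrightarrow> adm a c \<gamma> \<and> adm c b \<gamma>"
    and length_split:
      "adm a b \<gamma> \<Longrightarrow> a \<le> c \<Longrightarrow> c \<le> b \<Longrightarrow> len a b \<gamma> = len a c \<gamma> + len c b \<gamma>"
    and admissible_affine:
      "a \<le> b \<Longrightarrow> c \<le> d \<Longrightarrow> bij_betw (\<lambda>t. p * t + q) {c..d} {a..b}
        \<Longrightarrow> adm a b \<gamma> \<longleftrightarrow> adm c d (\<lambda>t. \<gamma> (p * t + q))"
    and length_affine:
      "adm a b \<gamma> \<Longrightarrow> c \<le> d \<Longrightarrow> bij_betw (\<lambda>t. p * t + q) {c..d} {a..b}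
        \<Longrightarrow> len a b \<gamma> = len c d (\<lambda>t. \<gamma> (p * t + q))"
    and length_continuous: "adm a b \<gamma> \<Longrightarrow> continuous_on {a..b} (\<lambda>t. len a t \<gamma>)"
    and length_lower_bound:
      "x \<in> interior U
        \<Longrightarrow> \<exists>\<epsilon>>0. \<forall>a b \<gamma>. adm a b \<gamma> \<and> \<gamma> a = x \<and> \<gamma> b \<notin> U \<longrightarrow> len a b \<gamma> > \<epsilon>"
    and admissible_const: "a \<le> b \<Longrightarrow> adm a b (\<lambda>_. x)"

(* Taken in the extended reals so that the infimum of the empty set is infinity. *)

definition length_dist ::
  "(real \<Rightarrow> real \<Rightarrow> (real \<Rightarrow> 'a) \<Rightarrow> bool) \<Rightarrow> (real \<Rightarrow> real \<Rightarrow> (real \<Rightarrow> 'a) \<Rightarrow> real)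
    \<Rightarrow> 'a \<Rightarrow> 'a \<Rightarrow> ereal" where
  "length_dist adm len x y =
    Inf {ereal (len a b \<gamma>) | a b \<gamma>. adm a b \<gamma> \<and> x \<in> \<gamma> ` {a..b} \<and> y \<in> \<gamma> ` {a..b}}"

(* In the class metric_space the topology is the one induced by dist, so the equation below says
   that the length distance is a (finite) distance inducing the given topology. *)

locale length_space = length_structure adm len
  for adm :: "real \<Rightarrow> real \<Rightarrow> (real \<Rightarrow> 'a::metric_space) \<Rightarrow> bool"
    and len :: "real \<Rightarrow> real \<Rightarrow> (real \<Rightarrow> 'a) \<Rightarrow> real" +
  assumes dist_eq: "ereal (dist x y) = length_dist adm len x y"

definition Ran :: "'a set set" where
  "Ran = {X. finite X \<and> X \<noteq> {}}"

(* The value of a weight at 0 is irrelevant. *)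

definition weight :: "(nat \<Rightarrow> real) \<Rightarrow> bool" where
  "weight \<omega> \<longleftrightarrow> \<omega> 1 = 1 \<and> (\<forall>n\<ge>1. 1 \<le> \<omega> n) \<and> mono_on {1..} \<omega>"

definition surj_relation :: "'a set \<Rightarrow> 'a set \<Rightarrow> ('a \<times> 'a) set \<Rightarrow> bool" where
  "surj_relation X Y R \<longleftrightarrow> R \<subseteq> X \<times> Y \<and> fst ` R = X \<and> snd ` R = Y"

definition rel_length :: "(nat \<Rightarrow> real) \<Rightarrow> ('a::metric_space \<times> 'a) set \<Rightarrow> real" where
  "rel_length \<omega> R = \<omega> (card R) * (\<Sum>(x, y)\<in>R. dist x y)"

definition comb_chain ::
  "'a set \<Rightarrow> 'a set \<Rightarrow> nat \<Rightarrow> (nat \<Rightarrow> 'a set) \<Rightarrow> (nat \<Rightarrow> ('a \<times> 'a) set) \<Rightarrow> bool" where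
  "comb_chain X Y k Z R \<longleftrightarrow> Z 0 = X \<and> Z k = Y \<and> (\<forall>j\<le>k. Z j \<in> Ran)
    \<and> (\<forall>j<k. surj_relation (Z j) (Z (Suc j)) (R j))"

(* For X and Y in Ran the product of X and Y is itself a surjective relation, so this infimum is
   over a nonempty set of nonnegative reals. *)

definition ran_dist :: "(nat \<Rightarrow> real) \<Rightarrow> 'a::metric_space set \<Rightarrow> 'a set \<Rightarrow> real" where
  "ran_dist \<omega> X Y = Inf {\<Sum>j<k. rel_length \<omega> (R j) | k Z R. comb_chain X Y k Z R}"

definition subdivision :: "real \<Rightarrow> real \<Rightarrow> nat \<Rightarrow> (nat \<Rightarrow> real) \<Rightarrow> bool" where
  "subdivision a b k t \<longleftrightarrow> t 0 = a \<and> t k = b \<and> (\<forall>i<k. t i < t (Suc i))"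

(* The components of the i-th piece are \<gamma> i 0, ..., \<gamma> i (n i - 1). *)

definition ran_lift ::
  "real \<Rightarrow> real \<Rightarrow> (real \<Rightarrow> 'a::topological_space set) \<Rightarrow> nat \<Rightarrow> (nat \<Rightarrow> real) \<Rightarrow> (nat \<Rightarrow> nat)
    \<Rightarrow> (nat \<Rightarrow> nat \<Rightarrow> real \<Rightarrow> 'a) \<Rightarrow> bool" where
  "ran_lift a b \<Gamma> k t n \<gamma> \<longleftrightarrow> subdivision a b k t
    \<and> (\<forall>i<k. 1 \<le> n i
        \<and> (\<forall>j<n i. continuous_on {t i..t (Suc i)} (\<gamma> i j))
        \<and> (\<forall>s\<in>{t i..t (Suc i)}. (\<lambda>j. \<gamma> i j s) ` {..<n i} = \<Gamma> s))"

definition admissible_lift ::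
  "(real \<Rightarrow> real \<Rightarrow> (real \<Rightarrow> 'a::topological_space) \<Rightarrow> bool) \<Rightarrow> real \<Rightarrow> real \<Rightarrow> (real \<Rightarrow> 'a set)
    \<Rightarrow> nat \<Rightarrow> (nat \<Rightarrow> real) \<Rightarrow> (nat \<Rightarrow> nat) \<Rightarrow> (nat \<Rightarrow> nat \<Rightarrow> real \<Rightarrow> 'a) \<Rightarrow> bool" where
  "admissible_lift adm a b \<Gamma> k t n \<gamma> \<longleftrightarrow>
    ran_lift a b \<Gamma> k t n \<gamma> \<and> (\<forall>i<k. \<forall>j<n i. adm (t i) (t (Suc i)) (\<gamma> i j))"

definition lift_length ::
  "(real \<Rightarrow> real \<Rightarrow> (real \<Rightarrow> 'a) \<Rightarrow> real) \<Rightarrow> (nat \<Rightarrow> real)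
    \<Rightarrow> nat \<Rightarrow> (nat \<Rightarrow> real) \<Rightarrow> (nat \<Rightarrow> nat) \<Rightarrow> (nat \<Rightarrow> nat \<Rightarrow> real \<Rightarrow> 'a) \<Rightarrow> real" where
  "lift_length len \<omega> k t n \<gamma> =
    (\<Sum>i<k. \<omega> (n i) * (\<Sum>j<n i. len (t i) (t (Suc i)) (\<gamma> i j)))"

(* Continuity is meant for the metric ran_dist \<omega>. It follows from the existence of a lift, except
   that for a = b the empty lift does not ensure \<Gamma> a \<in> Ran, which is therefore stated. *)

definition ran_path :: "(nat \<Rightarrow> real) \<Rightarrow> real \<Rightarrow> real \<Rightarrow> (real \<Rightarrow> 'a::metric_space set) \<Rightarrow> bool" where
  "ran_path \<omega> a b \<Gamma> \<longleftrightarrow> a \<le> b \<and> \<Gamma> ` {a..b} \<subseteq> Ran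
    \<and> (\<forall>t\<in>{a..b}. ((\<lambda>s. ran_dist \<omega> (\<Gamma> s) (\<Gamma> t)) \<longlongrightarrow> 0) (at t within {a..b}))"

definition admissible_ran_path ::
  "(real \<Rightarrow> real \<Rightarrow> (real \<Rightarrow> 'a::metric_space) \<Rightarrow> bool) \<Rightarrow> (nat \<Rightarrow> real)
    \<Rightarrow> real \<Rightarrow> real \<Rightarrow> (real \<Rightarrow> 'a set) \<Rightarrow> bool" where
  "admissible_ran_path adm \<omega> a b \<Gamma> \<longleftrightarrow>
    ran_path \<omega> a b \<Gamma> \<and> (\<exists>k t n \<gamma>. admissible_lift adm a b \<Gamma> k t n \<gamma>)"

(* Meaningful for admissible \<Gamma>, where the set is nonempty and bounded below by 0. *)

definition ran_length ::
  "(real \<Rightarrow> real \<Rightarrow> (real \<Rightarrow> 'a::metric_space) \<Rightarrow> bool) \<Rightarrow> (real \<Rightarrow> real \<Rightarrow> (real \<Rightarrow> 'a) \<Rightarrow> real)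
    \<Rightarrow> (nat \<Rightarrow> real) \<Rightarrow> real \<Rightarrow> real \<Rightarrow> (real \<Rightarrow> 'a set) \<Rightarrow> real" where
  "ran_length adm len \<omega> a b \<Gamma> =
    Inf {lift_length len \<omega> k t n \<gamma> | k t n \<gamma>. admissible_lift adm a b \<Gamma> k t n \<gamma>}"

definition crenelated ::
  "(real \<Rightarrow> real \<Rightarrow> (real \<Rightarrow> 'a::metric_space) \<Rightarrow> bool) \<Rightarrow> (nat \<Rightarrow> real)
    \<Rightarrow> real \<Rightarrow> real \<Rightarrow> (real \<Rightarrow> 'a set) \<Rightarrow> bool" where
  "crenelated adm \<omega> a b \<Gamma> \<longleftrightarrow> admissible_ran_path adm \<omega> a b \<Gamma>
    \<and> (\<exists>k t. subdivision a b k t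
        \<and> (\<forall>i<k. (\<lambda>s. card (\<Gamma> s)) constant_on {t i<..<t (Suc i)}))"

definition MBS_path ::
  "(real \<Rightarrow> real \<Rightarrow> (real \<Rightarrow> 'a::metric_space) \<Rightarrow> bool) \<Rightarrow> (nat \<Rightarrow> real)
    \<Rightarrow> real \<Rightarrow> real \<Rightarrow> (real \<Rightarrow> 'a set) \<Rightarrow> bool" where
  "MBS_path adm \<omega> a b \<Gamma> \<longleftrightarrow> crenelated adm \<omega> a b \<Gamma>
    \<and> (\<exists>c\<in>{a..b}. antimono_on {a..c} (\<lambda>t. card (\<Gamma> t)) \<and> mono_on {c..b} (\<lambda>t. card (\<Gamma> t)))"

end

theory Submission
  imports Defs
begin

text \<open>
  The length of every admissible lift bounds \<^term>\<open>ran_dist \<omega> X Y\<close> from above, because sampling the lift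
  at its subdivision points gives a combinatorial chain that is no longer.  So it is enough to
  construct one MBS-path with a lift of length at most \<^term>\<open>ran_dist \<omega> X Y\<close>, and this is done by
  induction on \<^term>\<open>card X + card Y\<close>.

  Any combinatorial chain can be rearranged, at no extra cost, so that all merging comes before all
  splitting.  A surjective relation that is minimal for inclusion is a disjoint union of stars, so
  it is a merging map followed by the inverse of a merging map (\<open>surj_relation_factor\<close>).  A
  splitting followed by a merging is again a single surjective relation, with at most as many
  edges; factoring it exchanges the two (\<open>merge_split_prepend_split\<close>).  Hence
  \<^term>\<open>ran_dist \<omega> X Y\<close> is the infimum of the costs of three kinds of chains: bijections from
  \<^term>\<open>X\<close> to \<^term>\<open>Y\<close>, chains that begin with a non-injective map on \<^term>\<open>X\<close>, and chains that
  end with the inverse of a non-injective map on \<^term>\<open>Y\<close>.  The first kind involves finitely many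
  maps.  For the other two, non-injectivity is a closed condition on the map, and only maps with
  bounded values matter, so the Heine-Borel property provides an optimal one
  (\<open>optimal_first_step\<close>).

  Given an optimal first map \<open>F\<close> on \<^term>\<open>X\<close>, move every point \<open>x\<close> of \<^term>\<open>X\<close> along a geodesic to
  \<open>F x\<close>, but only until the first time at which two of the points meet, say in the
  configuration \<open>X'\<close>.  Up to that time the cardinality is constant, then it drops; and the
  triangle inequality shows that this initial motion is still optimal, that is, its length plus
  \<open>ran_dist \<omega> X' Y\<close> is at most \<^term>\<open>ran_dist \<omega> X Y\<close> (\<open>optimal_initial_piece\<close>).  Since \<open>X'\<close>
  has fewer points than \<^term>\<open>X\<close>, induction applies to \<open>X'\<close> and \<^term>\<open>Y\<close>.  If no two points meet,
  then \<open>F\<close> is an optimal bijection and the motion ends at \<^term>\<open>Y\<close>.  A non-injective map on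
  \<^term>\<open>Y\<close> is treated in the same way with time reversed.  Pieces added at the beginning let the
  cardinality decrease and pieces added at the end let it increase, so the concatenated path is an
  MBS-path.
\<close>

section \<open>The weighted distance as a pseudometric\<close>

lemma RanI: "finite X \<Longrightarrow> X \<noteq> {} \<Longrightarrow> X \<in> Ran"
  and Ran_image: "X \<in> Ran \<Longrightarrow> f ` X \<in> Ran"
  and Ran_card: "X \<in> Ran \<Longrightarrow> 1 \<le> card X"
  by (auto simp: Ran_def Suc_le_eq card_gt_0_iff)

lemma surj_relation_finite:
  assumes "X \<in> Ran" "Y \<in> Ran" "surj_relation X Y R"
  shows "finite R" "R \<noteq> {}"
  using assms by (auto simp: surj_relation_def Ran_def dest: finite_subset)

lemma surj_relation_converse: "surj_relation X Y R \<Longrightarrow> surj_relation Y X (prod.swap ` R)"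
  unfolding surj_relation_def by (auto simp: image_image)

lemma surj_relation_image: "surj_relation (f ` I) (g ` I) ((\<lambda>i. (f i, g i)) ` I)"
  unfolding surj_relation_def by (auto simp: image_image)

locale weighted =
  fixes \<omega> :: "nat \<Rightarrow> real"
  assumes weight: "weight \<omega>"
begin

lemma weight_ge_1: "1 \<le> n \<Longrightarrow> 1 \<le> \<omega> n"
  using weight by (simp add: weight_def)

lemma weight_mono: "1 \<le> m \<Longrightarrow> m \<le> n \<Longrightarrow> \<omega> m \<le> \<omega> n"
  using weight unfolding weight_def by (intro mono_onD[of "{1..}" \<omega>]) auto

text \<open>
  The length of the graph of \<^term>\<open>F\<close>, seen as a surjective relation from \<^term>\<open>X\<close> to
  \<^term>\<open>F ` X\<close>.  It is also the length of the converse relation, so it measures splittings as well.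
\<close>
definition move :: "('a::metric_space \<Rightarrow> 'a) \<Rightarrow> 'a set \<Rightarrow> real" where
  "move F X = \<omega> (card X) * (\<Sum>x\<in>X. dist x (F x))"

lemma move_cong: "(\<And>x. x \<in> X \<Longrightarrow> F x = G x) \<Longrightarrow> move F X = move G X"
  unfolding move_def by simp

lemma rel_length_nonneg: "0 \<le> rel_length \<omega> R"
proof (cases "finite R \<and> R \<noteq> {}")
  case True
  then have "1 \<le> \<omega> (card R)"
    by (intro weight_ge_1) (simp add: Suc_le_eq card_gt_0_iff)
  then show ?thesis
    unfolding rel_length_def by (intro mult_nonneg_nonneg sum_nonneg) auto
qed (auto simp: rel_length_def)

lemma rel_length_converse: "rel_length \<omega> (prod.swap ` R) = rel_length \<omega> R"
  unfolding rel_length_def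
  by (simp add: card_image sum.reindex case_prod_unfold dist_commute)

text \<open>
  A relation given by an indexed family of edges: repeated edges only lower both the cardinality
  and the sum.
\<close>
lemma rel_length_image_le:
  assumes "finite I" "I \<noteq> {}"
  shows "rel_length \<omega> ((\<lambda>i. (f i, g i)) ` I) \<le> \<omega> (card I) * (\<Sum>i\<in>I. dist (f i) (g i))"
proof -
  let ?R = "(\<lambda>i. (f i, g i)) ` I"
  have "(\<Sum>(x, y)\<in>?R. dist x y) \<le> (\<Sum>i\<in>I. dist (f i) (g i))"
    using sum_image_le[of I "\<lambda>(x, y). dist x y" "\<lambda>i. (f i, g i)"] assms by (auto simp: comp_def)
  moreover have "\<omega> (card ?R) \<le> \<omega> (card I)"
    using assms by (intro weight_mono card_image_le) (auto simp: Suc_le_eq card_gt_0_iff)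
  moreover have "0 \<le> \<omega> (card I)"
    using weight_ge_1[of "card I"] assms by (simp add: Suc_le_eq card_gt_0_iff)
  ultimately show ?thesis
    unfolding rel_length_def by (intro mult_mono sum_nonneg) auto
qed

lemma ran_dist_le_chain:
  assumes "comb_chain X Y k Z R"
  shows "ran_dist \<omega> X Y \<le> (\<Sum>j<k. rel_length \<omega> (R j))"
  unfolding ran_dist_def
proof (rule cInf_lower)
  show "bdd_below {\<Sum>j<k. rel_length \<omega> (R j) |k Z R. comb_chain X Y k Z R}"
    by (rule bdd_belowI[of _ 0]) (auto intro!: sum_nonneg rel_length_nonneg)
qed (use assms in blast)

lemma comb_chain_single:
  assumes "X \<in> Ran" "Y \<in> Ran" "surj_relation X Y R"
  shows "comb_chain X Y 1 (case_nat X (\<lambda>_. Y)) (\<lambda>_. R)"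
  using assms by (auto simp: comb_chain_def split: nat.split)

lemma ran_dist_le_rel_length:
  assumes "X \<in> Ran" "Y \<in> Ran" "surj_relation X Y R"
  shows "ran_dist \<omega> X Y \<le> rel_length \<omega> R"
  using ran_dist_le_chain[OF comb_chain_single[OF assms]] by simp

lemma ex_comb_chain:
  assumes "X \<in> Ran" "Y \<in> Ran"
  shows "\<exists>k Z R. comb_chain X Y k Z R"
proof -
  have "surj_relation X Y (X \<times> Y)"
    using assms by (auto simp: surj_relation_def Ran_def)
  then show ?thesis
    using comb_chain_single[OF assms] by blast
qed

lemma ran_dist_greatest:
  assumes "X \<in> Ran" "Y \<in> Ran"
    and "\<And>k Z R. comb_chain X Y k Z R \<Longrightarrow> m \<le> (\<Sum>j<k. rel_length \<omega> (R j))"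
  shows "m \<le> ran_dist \<omega> X Y"
  unfolding ran_dist_def using ex_comb_chain[OF assms(1,2)] assms(3)
  by (intro cInf_greatest) auto

lemma ran_dist_nonneg: "X \<in> Ran \<Longrightarrow> Y \<in> Ran \<Longrightarrow> 0 \<le> ran_dist \<omega> X Y"
  by (rule ran_dist_greatest) (auto intro!: sum_nonneg rel_length_nonneg)

text \<open>
  With this rule a statement about the length of a chain is proved by adding one relation at a time
  at the front, without handling the indices of the chain.
\<close>
lemma comb_chain_induct [consumes 1, case_names refl step]:
  assumes "comb_chain X Y k Z R"
    and refl: "Y \<in> Ran \<Longrightarrow> P Y 0"
    and step: "\<And>X X' R c. X \<in> Ran \<Longrightarrow> X' \<in> Ran \<Longrightarrow> surj_relation X X' R \<Longrightarrow> P X' c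
        \<Longrightarrow> P X (rel_length \<omega> R + c)"
  shows "P X (\<Sum>j<k. rel_length \<omega> (R j))"
  using assms(1)
proof (induction k arbitrary: X Z R)
  case 0
  then have "X = Y" "Y \<in> Ran" by (auto simp: comb_chain_def)
  then show ?case using refl by simp
next
  case (Suc k)
  have "comb_chain (Z 1) Y k (Z \<circ> Suc) (R \<circ> Suc)" and "surj_relation X (Z 1) (R 0)"
    and "X \<in> Ran" and "Z 1 \<in> Ran"
    using Suc.prems unfolding comb_chain_def by auto
  then have "P X (rel_length \<omega> (R 0) + (\<Sum>j<k. rel_length \<omega> ((R \<circ> Suc) j)))"
    by (intro step Suc.IH)
  then show ?case
    unfolding sum.lessThan_Suc_shift by simp
qed

lemma ran_dist_step:
  assumes "X \<in> Ran" "surj_relation X X' R" "X' \<in> Ran" "Y \<in> Ran"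
  shows "ran_dist \<omega> X Y \<le> rel_length \<omega> R + ran_dist \<omega> X' Y"
proof -
  have "ran_dist \<omega> X Y - rel_length \<omega> R \<le> ran_dist \<omega> X' Y"
  proof (rule ran_dist_greatest)
    fix k Z S assume "comb_chain X' Y k Z S"
    then have "comb_chain X Y (Suc k) (case_nat X Z) (case_nat R S)"
      using assms by (auto simp: comb_chain_def le_Suc_eq split: nat.split)
    then have "ran_dist \<omega> X Y \<le> (\<Sum>j<Suc k. rel_length \<omega> (case_nat R S j))"
      by (rule ran_dist_le_chain)
    then show "ran_dist \<omega> X Y - rel_length \<omega> R \<le> (\<Sum>j<k. rel_length \<omega> (S j))"
      unfolding sum.lessThan_Suc_shift by simp
  qed (use assms in auto)
  then show ?thesis by simp
qed

lemma ran_dist_triangle: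
  assumes "X \<in> Ran" "Y \<in> Ran" "W \<in> Ran"
  shows "ran_dist \<omega> X W \<le> ran_dist \<omega> X Y + ran_dist \<omega> Y W"
proof -
  have "ran_dist \<omega> X W - ran_dist \<omega> Y W \<le> ran_dist \<omega> X Y"
  proof (rule ran_dist_greatest)
    fix k Z R assume "comb_chain X Y k Z R"
    then have "ran_dist \<omega> X W \<le> (\<Sum>j<k. rel_length \<omega> (R j)) + ran_dist \<omega> Y W"
    proof (induction rule: comb_chain_induct)
      case (step X X' R c)
      then show ?case using ran_dist_step[of X X' R W] assms by linarith
    qed simp
    then show "ran_dist \<omega> X W - ran_dist \<omega> Y W \<le> (\<Sum>j<k. rel_length \<omega> (R j))" by simp
  qed (use assms in auto)
  then show ?thesis by simp
qed

lemma ran_dist_self: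
  assumes "X \<in> Ran"
  shows "ran_dist \<omega> X X = 0"
proof -
  have "comb_chain X X 0 (\<lambda>_. X) (\<lambda>_. {})"
    using assms by (simp add: comb_chain_def)
  from ran_dist_le_chain[OF this] ran_dist_nonneg[OF assms assms] show ?thesis by simp
qed

lemma ran_dist_commute:
  assumes "X \<in> Ran" "Y \<in> Ran"
  shows "ran_dist \<omega> X Y = ran_dist \<omega> Y X"
proof -
  have le: "ran_dist \<omega> Y X \<le> ran_dist \<omega> X Y"
    if "X \<in> Ran" "Y \<in> Ran" for X Y :: "'a set"
  proof (rule ran_dist_greatest)
    fix k Z R assume "comb_chain X Y k Z R"
    then show "ran_dist \<omega> Y X \<le> (\<Sum>j<k. rel_length \<omega> (R j))"
    proof (induction rule: comb_chain_induct)
      case (step X X' R c)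
      have "ran_dist \<omega> X' X \<le> rel_length \<omega> R"
        using ran_dist_le_rel_length[OF _ _ surj_relation_converse[OF step(3)]] step
        by (simp add: rel_length_converse)
      then show ?case using ran_dist_triangle[of Y X' X] step that by linarith
    qed (simp add: ran_dist_self)
  qed (use that in auto)
  show ?thesis using le[OF assms] le[OF assms(2,1)] by simp
qed

text \<open>
  The main source of upper bounds: two configurations indexed by the same set are joined by
  moving each point straight to the point with the same index.
\<close>
lemma ran_dist_image_le:
  assumes "finite I" "I \<noteq> {}"
  shows "ran_dist \<omega> (f ` I) (g ` I) \<le> \<omega> (card I) * (\<Sum>i\<in>I. dist (f i) (g i))"
proof -
  have "ran_dist \<omega> (f ` I) (g ` I) \<le> rel_length \<omega> ((\<lambda>i. (f i, g i)) ` I)"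
    by (rule ran_dist_le_rel_length) (use assms in \<open>auto intro: RanI surj_relation_image\<close>)
  also have "\<dots> \<le> \<omega> (card I) * (\<Sum>i\<in>I. dist (f i) (g i))"
    by (rule rel_length_image_le) fact+
  finally show ?thesis .
qed

section \<open>Merging before splitting\<close>

text \<open>
  In a surjective relation that is minimal for inclusion, no edge has another edge at both of its
  ends, for such an edge could be removed.  In other words, the relation is a disjoint union of
  stars.
\<close>
lemma minimal_surj_relation:
  assumes "X \<in> Ran" "Y \<in> Ran" "surj_relation X Y R"
  obtains S where "S \<subseteq> R" "surj_relation X Y S"
    "\<And>x y x' y'. (x, y) \<in> S \<Longrightarrow> (x, y') \<in> S \<Longrightarrow> (x', y) \<in> S \<Longrightarrow> y' = y \<or> x' = x"
proof -
  let ?P = "\<lambda>S. S \<subseteq> R \<and> surj_relation X Y S"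
  obtain S where S: "?P S" and least: "\<And>S'. ?P S' \<Longrightarrow> card S \<le> card S'"
    using ex_has_least_nat[of ?P R card] assms by blast
  have "finite S"
    using S surj_relation_finite[OF assms] finite_subset by blast
  have "y' = y \<or> x' = x" if "(x, y) \<in> S" "(x, y') \<in> S" "(x', y) \<in> S" for x y x' y'
  proof (rule ccontr)
    assume ne: "\<not> (y' = y \<or> x' = x)"
    have "surj_relation X Y (S - {(x, y)})"
      unfolding surj_relation_def
    proof (intro conjI subset_antisym)
      show "X \<subseteq> fst ` (S - {(x, y)})"
      proof
        fix z assume "z \<in> X"
        then obtain w where "(z, w) \<in> S" using S unfolding surj_relation_def by force
        then show "z \<in> fst ` (S - {(x, y)})"
          using that ne by (cases "(z, w) = (x, y)") force+
      qed
      show "Y \<subseteq> snd ` (S - {(x, y)})"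
      proof
        fix w assume "w \<in> Y"
        then obtain z where "(z, w) \<in> S" using S unfolding surj_relation_def by force
        then show "w \<in> snd ` (S - {(x, y)})"
          using that ne by (cases "(z, w) = (x, y)") force+
      qed
    qed (use S in \<open>auto simp: surj_relation_def\<close>)
    then have "card S \<le> card (S - {(x, y)})"
      using S by (intro least) auto
    with that \<open>finite S\<close> show False
      by (metis card_Diff1_less leD)
  qed
  with S show thesis by (intro that[of S]) auto
qed

text \<open>
  In a disjoint union of stars, first contract every star with centre in \<^term>\<open>Y\<close> to its centre, then
  expand every star with centre in \<^term>\<open>X\<close>.  Each edge is traversed in exactly one of the two
  steps, and neither step involves more points than the relation has edges.
\<close>
lemma surj_relation_factor:
  assumes X: "X \<in> Ran" and Y: "Y \<in> Ran" and R: "surj_relation X Y R"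
  obtains F G where "F ` X = G ` Y" "move F X + move G Y \<le> rel_length \<omega> R"
proof -
  obtain S where S: "S \<subseteq> R" "surj_relation X Y S"
    and min: "\<And>x y x' y'. (x, y) \<in> S \<Longrightarrow> (x, y') \<in> S \<Longrightarrow> (x', y) \<in> S \<Longrightarrow> y' = y \<or> x' = x"
    using minimal_surj_relation[OF assms] by blast
  have fin: "finite R" "finite S" "finite X" "finite Y"
    using surj_relation_finite[OF assms] S X Y by (auto simp: Ran_def dest: finite_subset)
  have exX: "\<exists>y. (x, y) \<in> S" if "x \<in> X" for x
    using S(2) that unfolding surj_relation_def by force
  have exY: "\<exists>x. (x, y) \<in> S" if "y \<in> Y" for y
    using S(2) that unfolding surj_relation_def by force
  have memX: "x \<in> X" and memY: "y \<in> Y" if "(x, y) \<in> S" for x y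
    using S(2) that unfolding surj_relation_def by auto
  \<comment> \<open>The points with a single edge follow it under \<open>F\<close>; the centres of stars in \<open>X\<close> with several
    edges stay put, and the other ends of these edges are sent back to the centre by \<open>G\<close>.\<close>
  define leaf where "leaf x \<longleftrightarrow> (\<exists>!y. (x, y) \<in> S)" for x
  define F where "F x = (if leaf x then THE y. (x, y) \<in> S else x)" for x
  define centre where "centre y x \<longleftrightarrow> (x, y) \<in> S \<and> \<not> leaf x" for y x
  define G where "G y = (if \<exists>x. centre y x then SOME x. centre y x else y)" for y
  have F_leaf: "F x = y" if "(x, y) \<in> S" "leaf x" for x y
    using that unfolding F_def leaf_def by (auto intro: the1_equality)
  have G_centre: "G y = x" if "centre y x" for y x
  proof -
    \<comment> \<open>The edge at \<open>y\<close> coming from a centre is the only edge at \<open>y\<close>, by minimality.\<close>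
    have u: "x' = x" if x': "centre y x'" for x'
    proof -
      obtain y' where "(x, y') \<in> S" "y' \<noteq> y"
        using \<open>centre y x\<close> unfolding centre_def leaf_def by blast
      then show "x' = x"
        using min[of x y y' x'] that \<open>centre y x\<close> x' unfolding centre_def by blast
    qed
    have "(SOME x. centre y x) = x"
      using u that by (rule some_equality[rotated])
    then show ?thesis using that unfolding G_def by auto
  qed
  have nocentre: "\<not> centre y x'" if "(x, y) \<in> S" "leaf x" for x y x'
  proof
    assume c: "centre y x'"
    then obtain y' where "(x', y') \<in> S" "y' \<noteq> y"
      unfolding centre_def leaf_def by blast
    then have "x = x'"
      using min[of x' y y' x] that c unfolding centre_def by blast
    with c that show False unfolding centre_def by blast
  qed
  have image: "F ` X = G ` Y"
  proof (intro subset_antisym image_subsetI)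
    fix x assume "x \<in> X"
    then obtain y where y: "(x, y) \<in> S" using exX by blast
    show "F x \<in> G ` Y"
    proof (cases "leaf x")
      case True
      then have "F x = y" "G y = y" using y F_leaf nocentre unfolding G_def by auto
      then show ?thesis using memY[OF y] by (metis imageI)
    next
      case False
      then have "F x = x" "G y = x" using y G_centre unfolding F_def centre_def by auto
      then show ?thesis using memY[OF y] by (metis imageI)
    qed
  next
    fix y assume "y \<in> Y"
    show "G y \<in> F ` X"
    proof (cases "\<exists>x. centre y x")
      case True
      then obtain x where x: "centre y x" by blast
      then have "G y = x" "F x = x" "x \<in> X"
        using G_centre memX unfolding F_def centre_def by auto
      then show ?thesis by (metis imageI)
    next
      case False
      obtain x where x: "(x, y) \<in> S" using exY \<open>y \<in> Y\<close> by blast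
      then have "leaf x" using False unfolding centre_def by blast
      then have "F x = y" "G y = y" using x F_leaf False unfolding G_def by auto
      then show ?thesis using memX[OF x] by (metis imageI)
    qed
  qed
  \<comment> \<open>The edges used by \<open>F\<close> start at leaves and those used by \<open>G\<close> at centres, so no edge is counted
    twice.\<close>
  let ?A = "{x \<in> X. leaf x}" and ?B = "{y \<in> Y. \<exists>x. centre y x}"
  let ?d = "\<lambda>(x, y). dist x y"
  have "(\<Sum>x\<in>X. dist x (F x)) + (\<Sum>y\<in>Y. dist y (G y))
      = (\<Sum>x\<in>?A. dist x (F x)) + (\<Sum>y\<in>?B. dist y (G y))"
  proof -
    have "(\<Sum>x\<in>X. dist x (F x)) = (\<Sum>x\<in>?A. dist x (F x))"
      by (rule sum.mono_neutral_right) (use fin in \<open>auto simp: F_def\<close>)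
    moreover have "(\<Sum>y\<in>Y. dist y (G y)) = (\<Sum>y\<in>?B. dist y (G y))"
      by (rule sum.mono_neutral_right) (use fin in \<open>auto simp: G_def\<close>)
    ultimately show ?thesis by simp
  qed
  also have "\<dots> = sum ?d ((\<lambda>x. (x, F x)) ` ?A) + sum ?d ((\<lambda>y. (G y, y)) ` ?B)"
    by (subst (1 2) sum.reindex) (auto simp: inj_on_def dist_commute)
  also have "\<dots> = sum ?d ((\<lambda>x. (x, F x)) ` ?A \<union> (\<lambda>y. (G y, y)) ` ?B)"
  proof (rule sum.union_disjoint[symmetric])
    show "(\<lambda>x. (x, F x)) ` ?A \<inter> (\<lambda>y. (G y, y)) ` ?B = {}"
      using G_centre unfolding centre_def by force
  qed (use fin in auto)
  also have "\<dots> \<le> sum ?d R"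
  proof (rule sum_mono2)
    have "(x, F x) \<in> S" if "x \<in> X" "leaf x" for x
      using F_leaf exX that by metis
    moreover have "(G y, y) \<in> S" if "centre y x" for x y
      using G_centre that unfolding centre_def by metis
    ultimately show "(\<lambda>x. (x, F x)) ` ?A \<union> (\<lambda>y. (G y, y)) ` ?B \<subseteq> R"
      using S(1) by blast
  qed (use fin in auto)
  finally have sum: "(\<Sum>x\<in>X. dist x (F x)) + (\<Sum>y\<in>Y. dist y (G y)) \<le> sum ?d R" .
  have cX: "\<omega> (card X) \<le> \<omega> (card R)" and cY: "\<omega> (card Y) \<le> \<omega> (card R)"
    using R X Y fin card_image_le[of R fst] card_image_le[of R snd]
    by (intro weight_mono Ran_card; simp add: surj_relation_def)+
  have "move F X + move G Y
      \<le> \<omega> (card R) * (\<Sum>x\<in>X. dist x (F x)) + \<omega> (card R) * (\<Sum>y\<in>Y. dist y (G y))"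
    unfolding move_def using cX cY by (intro add_mono mult_right_mono sum_nonneg) auto
  also have "\<dots> \<le> rel_length \<omega> R"
    unfolding rel_length_def distrib_left[symmetric]
    using sum weight_ge_1[of "card X"] Ran_card[OF X] cX by (intro mult_left_mono) auto
  finally show thesis by (rule that[OF image])
qed

lemma dist_le_move:
  assumes "X \<in> Ran" "x \<in> X"
  shows "dist x (F x) \<le> move F X"
proof -
  have "dist x (F x) \<le> (\<Sum>x\<in>X. dist x (F x))"
    using assms by (intro member_le_sum) (auto simp: Ran_def)
  also have "\<dots> \<le> move F X"
    unfolding move_def using weight_ge_1[OF Ran_card, of X] assms
    using mult_right_mono[of 1 "\<omega> (card X)" "\<Sum>x\<in>X. dist x (F x)"] by (simp add: sum_nonneg)
  finally show ?thesis .
qed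

lemma ran_dist_le_move: "X \<in> Ran \<Longrightarrow> ran_dist \<omega> X (F ` X) \<le> move F X"
  unfolding move_def using ran_dist_image_le[of X "\<lambda>x. x" F] by (simp add: Ran_def)

lemma move_comp_le:
  assumes "X \<in> Ran" "inj_on h X"
  shows "move (F \<circ> h) X \<le> move h X + move F (h ` X)"
proof -
  have "(\<Sum>x\<in>X. dist x (F (h x))) \<le> (\<Sum>x\<in>X. dist x (h x) + dist (h x) (F (h x)))"
    by (intro sum_mono dist_triangle)
  then show ?thesis
    unfolding move_def card_image[OF assms(2)] sum.reindex[OF assms(2)] distrib_left[symmetric]
    using weight_ge_1[OF Ran_card[OF assms(1)]]
    by (intro mult_left_mono) (auto simp: sum.distrib)
qed

text \<open>
  Chains of the form ``merge, then split'', built from the outside inwards: at every stage a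
  non-injective map is applied to one of the two ends, until the ends are in bijection.  The last
  argument is an upper bound for the total length, with slack allowed at each stage so that the
  estimates below need no exact values.
\<close>
inductive merge_split :: "'a::metric_space set \<Rightarrow> 'a set \<Rightarrow> real \<Rightarrow> bool" where
  bijection: "X \<in> Ran \<Longrightarrow> bij_betw F X Y \<Longrightarrow> move F X \<le> c \<Longrightarrow> merge_split X Y c"
| merge_left: "X \<in> Ran \<Longrightarrow> \<not> inj_on F X \<Longrightarrow> merge_split (F ` X) Y c' \<Longrightarrow> move F X + c' \<le> c
    \<Longrightarrow> merge_split X Y c"
| merge_right: "Y \<in> Ran \<Longrightarrow> \<not> inj_on F Y \<Longrightarrow> merge_split X (F ` Y) c' \<Longrightarrow> move F Y + c' \<le> c
    \<Longrightarrow> merge_split X Y c"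

lemma move_inverse:
  assumes "bij_betw F X Y"
  shows "move (the_inv_into X F) Y = move F X"
proof -
  have "inj_on F X" "Y = F ` X" using assms by (auto simp: bij_betw_def)
  then show ?thesis
    unfolding move_def
    by (simp add: card_image sum.reindex the_inv_into_f_f dist_commute cong: sum.cong)
qed

lemma merge_split_bijection_right:
  assumes "Y \<in> Ran" "bij_betw G Y X" "move G Y \<le> c"
  shows "merge_split X Y c"
proof (rule bijection)
  show "X \<in> Ran" using assms Ran_image by (auto simp: bij_betw_def)
  show "bij_betw (the_inv_into Y G) X Y" by (rule bij_betw_the_inv_into[OF assms(2)])
  show "move (the_inv_into Y G) X \<le> c" using assms move_inverse by metis
qed

lemma merge_split_refl: "X \<in> Ran \<Longrightarrow> merge_split X X 0"
  by (rule bijection[of X "\<lambda>x. x"]) (auto simp: move_def bij_betw_def)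

text \<open>
  An injective map does not change the number of points, so by the triangle inequality it can be
  absorbed into the next step.
\<close>
lemma merge_split_prepend_move:
  assumes "merge_split (h ` X) Y c" "X \<in> Ran" "move h X + c \<le> d"
  shows "merge_split X Y d"
proof (cases "inj_on h X")
  case False
  then show ?thesis using assms by (auto intro: merge_left)
next
  case True
  from assms True show ?thesis
  proof (induction "h ` X" Y c arbitrary: d rule: merge_split.induct)
    case (bijection F Y c)
    show ?case
    proof (rule merge_split.bijection)
      show "bij_betw (F \<circ> h) X Y"
        using bijection by (auto simp: bij_betw_def intro: comp_inj_on)
      show "move (F \<circ> h) X \<le> d"
        using move_comp_le[of X h F] bijection by linarith
    qed fact
  next
    case (merge_left F Y c' c)
    show ?case
    proof (rule merge_split.merge_left)
      show "\<not> inj_on (F \<circ> h) X"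
        using merge_left by (auto dest: inj_on_imageI)
      show "merge_split ((F \<circ> h) ` X) Y c'"
        using merge_left by (simp add: image_comp)
      show "move (F \<circ> h) X + c' \<le> d"
        using move_comp_le[of X h F] merge_left by linarith
    qed fact
  next
    case (merge_right Y F c' c)
    show ?case
    proof (rule merge_split.merge_right)
      show "merge_split X (F ` Y) (move h X + c')"
        by (rule merge_right.hyps(4)) (use merge_right in auto)
      show "move F Y + (move h X + c') \<le> d"
        using merge_right by linarith
    qed fact+
  qed
qed

text \<open>
  The exchange of a splitting, from \<^term>\<open>g ` W\<close> to \<^term>\<open>W\<close>, with the mergings that follow it.
  When the chain begins with a merging \<open>F\<close> of \<^term>\<open>W\<close>, the pairs \<open>(g w, F w)\<close> form a surjective
  relation with at most \<^term>\<open>card W\<close> edges.  Factoring that relation gives a merging followed by a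
  splitting, and the splitting meets the rest of the chain, which is shorter.
\<close>
lemma merge_split_prepend_split:
  assumes "merge_split W Y c" "W \<in> Ran" "move g W + c \<le> d"
  shows "merge_split (g ` W) Y d"
  using assms
proof (induction W Y c arbitrary: g d rule: merge_split.induct)
  case (bijection W F Y c)
  \<comment> \<open>A splitting followed by a bijection is a map from \<open>Y\<close> onto \<open>g ` W\<close>, read backwards.\<close>
  let ?G = "g \<circ> the_inv_into W F"
  have inv: "bij_betw (the_inv_into W F) Y W"
    by (rule bij_betw_the_inv_into) fact
  then have img: "the_inv_into W F ` Y = W" and inj: "inj_on (the_inv_into W F) Y"
    by (auto simp: bij_betw_def)
  have Y: "Y \<in> Ran" using bijection by (auto simp: bij_betw_def intro: Ran_image)
  have G: "?G ` Y = g ` W" using img by (metis image_comp)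
  have le: "move ?G Y \<le> d"
    using move_comp_le[OF Y inj, of g] bijection move_inverse[of F W Y] by (simp add: img)
  show ?case
  proof (cases "inj_on ?G Y")
    case True
    then show ?thesis
      using G le Y by (intro merge_split_bijection_right[of Y ?G]) (auto simp: bij_betw_def)
  next
    case False
    moreover have "merge_split (g ` W) (?G ` Y) 0"
      unfolding G using bijection by (intro merge_split_refl Ran_image)
    ultimately show ?thesis
      using le Y by (intro merge_right[of Y ?G _ 0]) auto
  qed
next
  case (merge_left W F Y c' c)
  have W: "finite W" "W \<noteq> {}" using merge_left by (auto simp: Ran_def)
  let ?R = "(\<lambda>w. (g w, F w)) ` W"
  have Ran: "g ` W \<in> Ran" "F ` W \<in> Ran" using merge_left by (auto intro: Ran_image)
  obtain F' G' where FG: "F' ` (g ` W) = G' ` (F ` W)"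
    and le: "move F' (g ` W) + move G' (F ` W) \<le> rel_length \<omega> ?R"
    by (rule surj_relation_factor[OF Ran surj_relation_image])
  have "rel_length \<omega> ?R \<le> \<omega> (card W) * (\<Sum>w\<in>W. dist (g w) (F w))"
    by (rule rel_length_image_le) fact+
  also have "\<dots> \<le> \<omega> (card W) * (\<Sum>w\<in>W. dist w (g w) + dist w (F w))"
    using weight_ge_1[OF Ran_card[OF merge_left(1)]]
    by (intro mult_left_mono sum_mono dist_triangle3) auto
  also have "\<dots> = move g W + move F W"
    unfolding move_def by (simp add: sum.distrib distrib_left)
  finally have R: "rel_length \<omega> ?R \<le> move g W + move F W" .
  have "merge_split (F' ` (g ` W)) Y (move G' (F ` W) + c')"
    unfolding FG by (rule merge_left.IH) (use Ran in auto)
  then show ?case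
    by (rule merge_split_prepend_move) (use Ran merge_left.hyps merge_left.prems le R in auto)
next
  case (merge_right Y F W c' c)
  show ?case
  proof (rule merge_split.merge_right)
    show "merge_split (g ` W) (F ` Y) (move g W + c')"
      by (rule merge_right.IH) (use merge_right in auto)
    show "move F Y + (move g W + c') \<le> d"
      using merge_right by linarith
  qed fact+
qed

lemma merge_split_of_chain:
  assumes "comb_chain X Y k Z R"
  shows "merge_split X Y (\<Sum>j<k. rel_length \<omega> (R j))"
  using assms
proof (induction rule: comb_chain_induct)
  case refl
  then show ?case by (rule merge_split_refl)
next
  case (step X X' R c)
  obtain F G where FG: "F ` X = G ` X'" "move F X + move G X' \<le> rel_length \<omega> R"
    by (rule surj_relation_factor[OF step(1-3)])
  have "merge_split (F ` X) Y (move G X' + c)"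
    unfolding FG by (rule merge_split_prepend_split[OF step(4) step(2)]) simp
  then show ?case
    by (rule merge_split_prepend_move) (use FG step in auto)
qed

lemma merge_split_Ran: "merge_split X Y c \<Longrightarrow> X \<in> Ran \<and> Y \<in> Ran"
  by (induction rule: merge_split.induct) (auto simp: bij_betw_def intro: Ran_image)

lemma ran_dist_le_merge_split:
  "merge_split X Y c \<Longrightarrow> ran_dist \<omega> X Y \<le> c"
proof (induction rule: merge_split.induct)
  case (bijection X F Y c)
  then show ?case using ran_dist_le_move[of X F] by (simp add: bij_betw_def)
next
  case (merge_left X F Y c' c)
  have "Y \<in> Ran" using merge_split_Ran merge_left by blast
  then show ?case
    using ran_dist_le_move[of X F] ran_dist_triangle[of X "F ` X" Y] merge_left
      Ran_image[of X F] by linarith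
next
  case (merge_right Y F X c' c)
  have "X \<in> Ran" using merge_split_Ran merge_right by blast
  then show ?case
    using ran_dist_le_move[of Y F] ran_dist_triangle[of X "F ` Y" Y] merge_right
      ran_dist_commute[of "F ` Y" Y] Ran_image[of Y F] by linarith
qed

section \<open>An optimal first step\<close>

text \<open>
  A compactness argument in the space of all functions with the product topology.  The functional
  is continuous since \<^term>\<open>ran_dist \<omega>\<close> changes by at most a multiple of the displacements.  A map
  that nearly attains the bound displaces no point by more than \<open>d + 1\<close>, because weights are at
  least 1.  The limit of non-injective maps on \<^term>\<open>X\<close> is non-injective.  Passing to the
  limit in one step, with the rest of the chain replaced by its infimum, avoids the question of
  what happens when points of later configurations come together in the limit.
\<close>
lemma optimal_merge_exists:
  fixes X Y :: "'a::metric_space set"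
  assumes heine_borel: "\<And>S :: 'a set. closed S \<Longrightarrow> bounded S \<Longrightarrow> compact S"
    and X: "X \<in> Ran" and Y: "Y \<in> Ran"
    and approx: "\<And>\<epsilon>. 0 < \<epsilon> \<Longrightarrow> \<exists>F. \<not> inj_on F X \<and> move F X + ran_dist \<omega> (F ` X) Y \<le> d + \<epsilon>"
  shows "\<exists>F. \<not> inj_on F X \<and> move F X + ran_dist \<omega> (F ` X) Y \<le> d"
proof -
  define \<Phi> where "\<Phi> F = move F X + ran_dist \<omega> (F ` X) Y" for F
  \<comment> \<open>Pinning the values outside \<open>X\<close> makes the product of the sets \<open>K x\<close> compact.\<close>
  define K where "K x = (if x \<in> X then cball x (d + 1) else {x})" for x
  define C where "C = (\<Union>x\<in>X. \<Union>y\<in>X - {x}. {F :: 'a \<Rightarrow> 'a. F x = F y})"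
  have fin: "finite X" "X \<noteq> {}" using X by (auto simp: Ran_def)
  have C_iff: "F \<in> C \<longleftrightarrow> \<not> inj_on F X" for F
    unfolding C_def inj_on_def by auto
  have coord: "continuous_on A (\<lambda>F :: 'a \<Rightarrow> 'a. F x)" for A x
    by (rule continuous_on_subset[OF continuous_on_product_coordinates]) simp
  have "compact (K x)" for x
    using heine_borel[of "cball x (d + 1)"] unfolding K_def by simp
  then have "compactin (product_topology (\<lambda>_. euclidean) UNIV) (PiE UNIV K)"
    by (simp add: compactin_PiE)
  then have "compact (PiE UNIV K)"
    by (simp add: euclidean_product_topology)
  moreover have "closed C"
    unfolding C_def using fin by (intro closed_UN ballI closed_Collect_eq coord finite_Diff)
  ultimately have compact: "compact (PiE UNIV K \<inter> C)"
    by (rule compact_Int_closed)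
  have inside: "\<exists>F \<in> PiE UNIV K \<inter> C. \<Phi> F \<le> d + \<epsilon>" if "0 < \<epsilon>" "\<epsilon> \<le> 1" for \<epsilon>
  proof -
    obtain F where F: "\<not> inj_on F X" "\<Phi> F \<le> d + \<epsilon>"
      using approx[OF \<open>0 < \<epsilon>\<close>] unfolding \<Phi>_def by blast
    define F' where "F' x = (if x \<in> X then F x else x)" for x
    have same: "F' ` X = F ` X" "move F' X = move F X" "\<not> inj_on F' X"
      using F(1) by (auto simp: F'_def inj_on_def move_def)
    have "dist x (F x) \<le> d + 1" if "x \<in> X" for x
      using dist_le_move[OF X that, of F] ran_dist_nonneg[OF Ran_image[OF X] Y, of F]
        F(2) \<open>\<epsilon> \<le> 1\<close> unfolding \<Phi>_def by linarith
    then have "F' \<in> PiE UNIV K"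
      by (auto simp: F'_def K_def)
    then show ?thesis
      using F(2) same unfolding \<Phi>_def C_iff[symmetric] by (intro bexI[of _ F']) auto
  qed
  have cont: "continuous_on A \<Phi>" for A
  proof -
    have "continuous_on UNIV (\<lambda>F. ran_dist \<omega> (F ` X) Y)"
      unfolding continuous_on_def
    proof
      fix F :: "'a \<Rightarrow> 'a"
      have "((\<lambda>F'. ran_dist \<omega> (F' ` X) Y - ran_dist \<omega> (F ` X) Y) \<longlongrightarrow> 0) (at F)"
      proof (rule Lim_null_comparison)
        show "\<forall>\<^sub>F F' in at F. norm (ran_dist \<omega> (F' ` X) Y - ran_dist \<omega> (F ` X) Y)
            \<le> \<omega> (card X) * (\<Sum>x\<in>X. dist (F' x) (F x))"
        proof (intro always_eventually allI)
          fix F' :: "'a \<Rightarrow> 'a"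
          have "ran_dist \<omega> (F' ` X) (F ` X) \<le> \<omega> (card X) * (\<Sum>x\<in>X. dist (F' x) (F x))"
            by (rule ran_dist_image_le[OF fin])
          then show "norm (ran_dist \<omega> (F' ` X) Y - ran_dist \<omega> (F ` X) Y)
              \<le> \<omega> (card X) * (\<Sum>x\<in>X. dist (F' x) (F x))"
            using Ran_image[OF X, of F] Ran_image[OF X, of F'] Y
              ran_dist_triangle[of "F' ` X" "F ` X" Y] ran_dist_triangle[of "F ` X" "F' ` X" Y]
              ran_dist_commute[of "F' ` X" "F ` X"] by simp
        qed
        have "((\<lambda>F'. F' x) \<longlongrightarrow> F x) (at F)" for x
          using coord[of UNIV x] by (simp add: continuous_on_def)
        then have "((\<lambda>F'. \<omega> (card X) * (\<Sum>x\<in>X. dist (F' x) (F x)))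
            \<longlongrightarrow> \<omega> (card X) * (\<Sum>x\<in>X. dist (F x) (F x))) (at F)"
          by (intro tendsto_intros)
        then show "((\<lambda>F'. \<omega> (card X) * (\<Sum>x\<in>X. dist (F' x) (F x))) \<longlongrightarrow> 0) (at F)"
          by simp
      qed
      then show "((\<lambda>F. ran_dist \<omega> (F ` X) Y) \<longlongrightarrow> ran_dist \<omega> (F ` X) Y) (at F)"
        by (rule LIM_zero_cancel)
    qed
    then have "continuous_on UNIV \<Phi>"
      unfolding \<Phi>_def move_def by (intro continuous_intros coord)
    then show ?thesis by (rule continuous_on_subset) simp
  qed
  have "PiE UNIV K \<inter> C \<noteq> {}" using inside[of 1] by auto
  then obtain F where F: "F \<in> PiE UNIV K \<inter> C"
    and least: "\<And>F'. F' \<in> PiE UNIV K \<inter> C \<Longrightarrow> \<Phi> F \<le> \<Phi> F'"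
    using continuous_attains_inf[OF compact _ cont] by blast
  have "\<Phi> F \<le> d"
  proof (rule field_le_epsilon)
    fix \<epsilon> :: real assume "0 < \<epsilon>"
    then obtain F' where "F' \<in> PiE UNIV K \<inter> C" "\<Phi> F' \<le> d + min \<epsilon> 1"
      using inside[of "min \<epsilon> 1"] by auto
    then show "\<Phi> F \<le> d + \<epsilon>" using least by fastforce
  qed
  then show ?thesis using F C_iff unfolding \<Phi>_def by blast
qed

text \<open>Up to their values outside \<^term>\<open>X\<close>, there are only finitely many bijections.\<close>
lemma optimal_bijection_exists:
  fixes X Y :: "'a::metric_space set"
  assumes X: "X \<in> Ran" and Y: "Y \<in> Ran"
    and approx: "\<And>\<epsilon>. 0 < \<epsilon> \<Longrightarrow> \<exists>F. bij_betw F X Y \<and> move F X \<le> d + \<epsilon>"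
  shows "\<exists>F. bij_betw F X Y \<and> move F X \<le> d"
proof -
  let ?B = "{F \<in> X \<rightarrow>\<^sub>E Y. bij_betw F X Y}"
  have restrict: "\<exists>G\<in>?B. move G X = move F X" if "bij_betw F X Y" for F
  proof
    show "restrict F X \<in> ?B"
      using that bij_betw_apply by (fastforce cong: bij_betw_cong)
  qed (auto intro: move_cong)
  have "finite ?B"
    using X Y by (auto simp: Ran_def intro!: finite_PiE)
  moreover have "?B \<noteq> {}"
    using approx[of 1] restrict by fastforce
  ultimately obtain F where F: "F \<in> ?B" and least: "\<And>G. G \<in> ?B \<Longrightarrow> move F X \<le> move G X"
    using ex_is_arg_min_if_finite[of ?B "\<lambda>F. move F X"] unfolding is_arg_min_linorder by auto
  have "move F X \<le> d"
  proof (rule field_le_epsilon)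
    fix \<epsilon> :: real assume "0 < \<epsilon>"
    then obtain G where "bij_betw G X Y" "move G X \<le> d + \<epsilon>" using approx by blast
    then show "move F X \<le> d + \<epsilon>" using restrict[of G] least by fastforce
  qed
  then show ?thesis using F by blast
qed

text \<open>
  Nearly optimal chains can be taken in ``merge, then split'' form, and one of the three rules of
  \<open>merge_split\<close> must then be the outermost one for arbitrarily small errors.
\<close>
lemma optimal_first_step:
  fixes X Y :: "'a::metric_space set"
  assumes heine_borel: "\<And>S :: 'a set. closed S \<Longrightarrow> bounded S \<Longrightarrow> compact S"
    and X: "X \<in> Ran" and Y: "Y \<in> Ran"
  shows "(\<exists>F. bij_betw F X Y \<and> move F X \<le> ran_dist \<omega> X Y)
    \<or> (\<exists>F. \<not> inj_on F X \<and> move F X + ran_dist \<omega> (F ` X) Y \<le> ran_dist \<omega> X Y)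
    \<or> (\<exists>F. \<not> inj_on F Y \<and> move F Y + ran_dist \<omega> (F ` Y) X \<le> ran_dist \<omega> X Y)"
proof -
  let ?d = "ran_dist \<omega> X Y"
  define A where "A \<epsilon> \<longleftrightarrow> (\<exists>F. bij_betw F X Y \<and> move F X \<le> ?d + \<epsilon>)" for \<epsilon>
  define B where "B \<epsilon> \<longleftrightarrow> (\<exists>F. \<not> inj_on F X \<and> move F X + ran_dist \<omega> (F ` X) Y \<le> ?d + \<epsilon>)" for \<epsilon>
  define C where "C \<epsilon> \<longleftrightarrow> (\<exists>F. \<not> inj_on F Y \<and> move F Y + ran_dist \<omega> (F ` Y) X \<le> ?d + \<epsilon>)" for \<epsilon>
  have mono: "A \<delta> \<Longrightarrow> A \<epsilon>" "B \<delta> \<Longrightarrow> B \<epsilon>" "C \<delta> \<Longrightarrow> C \<epsilon>" if "\<delta> \<le> \<epsilon>" for \<delta> \<epsilon>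
    using that unfolding A_def B_def C_def by (meson add_left_mono order_trans)+
  have some: "A \<epsilon> \<or> B \<epsilon> \<or> C \<epsilon>" if "0 < \<epsilon>" for \<epsilon>
  proof -
    have "\<exists>k Z R. comb_chain X Y k Z R \<and> (\<Sum>j<k. rel_length \<omega> (R j)) < ?d + \<epsilon>"
      using ran_dist_greatest[OF X Y, of "?d + \<epsilon>"] that by (meson add_le_same_cancel1 not_le)
    then obtain c where "merge_split X Y c" "c < ?d + \<epsilon>"
      using merge_split_of_chain by blast
    then show ?thesis
    proof (cases rule: merge_split.cases)
      case (bijection F)
      then show ?thesis using \<open>c < ?d + \<epsilon>\<close> unfolding A_def by force
    next
      case (merge_left F c')
      then show ?thesis
        using \<open>c < ?d + \<epsilon>\<close> ran_dist_le_merge_split[OF merge_left(3)] unfolding B_def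
        by (intro disjI2 disjI1 exI[of _ F]) linarith+
    next
      case (merge_right F c')
      have "ran_dist \<omega> (F ` Y) X \<le> c'"
        using ran_dist_le_merge_split[OF merge_right(3)]
          ran_dist_commute[OF X Ran_image[OF Y], of F] by simp
      then show ?thesis
        using \<open>c < ?d + \<epsilon>\<close> merge_right unfolding C_def
        by (intro disjI2 exI[of _ F]) linarith+
    qed
  qed
  have "(\<forall>\<epsilon>>0. A \<epsilon>) \<or> (\<forall>\<epsilon>>0. B \<epsilon>) \<or> (\<forall>\<epsilon>>0. C \<epsilon>)"
  proof (rule ccontr)
    assume "\<not> ?thesis"
    then obtain a b c where "0 < a" "0 < b" "0 < c" "\<not> A a" "\<not> B b" "\<not> C c" by blast
    then show False
      using some[of "min a (min b c)"] mono(1)[of "min a (min b c)" a]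
        mono(2)[of "min a (min b c)" b] mono(3)[of "min a (min b c)" c] by linarith
  qed
  then show ?thesis
    using optimal_bijection_exists[OF X Y, of ?d] optimal_merge_exists[OF heine_borel X Y, of ?d]
      optimal_merge_exists[OF heine_borel Y X, of ?d]
    unfolding A_def B_def C_def by blast
qed

end

section \<open>Geodesics up to the first collision\<close>
lemma bij_betw_affine:
  fixes p q c d :: real
  assumes "0 < p"
  shows "bij_betw (\<lambda>t. p * t + q) {c..d} {p * c + q..p * d + q}"
proof -
  have "(\<lambda>t. p * t + q) ` {c..d} = {p * c + q..p * d + q}"
  proof (intro subset_antisym subsetI)
    fix y assume "y \<in> {p * c + q..p * d + q}"
    then have "(y - q) / p \<in> {c..d}" using assms by (auto simp: field_simps)
    moreover have "y = p * ((y - q) / p) + q" using assms by simp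
    ultimately show "y \<in> (\<lambda>t. p * t + q) ` {c..d}" by blast
  qed (use assms in auto)
  then show ?thesis using assms by (auto simp: bij_betw_def inj_on_def)
qed

lemma bij_betw_reflect: "bij_betw (\<lambda>t. - 1 * t + 1 :: real) {0..1} {0..1}"
  by (rule bij_betw_byWitness[where f' = "\<lambda>t. 1 - t"]) auto

text \<open>
  The times at which two of finitely many moving points coincide form a compact set.  If some
  collision occurs, this set has a least element, which is positive since the points are distinct
  at time 0.
\<close>
lemma first_collision:
  fixes f :: "'b \<Rightarrow> real \<Rightarrow> 'a::metric_space"
  assumes "finite I" and cont: "\<And>i. i \<in> I \<Longrightarrow> continuous_on {0..1} (f i)"
    and start: "inj_on (\<lambda>i. f i 0) I"
    and "u \<in> {0..1}" "\<not> inj_on (\<lambda>i. f i u) I"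
  obtains t where "0 < t" "t \<le> 1" "\<not> inj_on (\<lambda>i. f i t) I"
    "\<And>s. 0 \<le> s \<Longrightarrow> s < t \<Longrightarrow> inj_on (\<lambda>i. f i s) I"
proof -
  define T where "T = (\<Union>i\<in>I. \<Union>j\<in>I - {i}. {s \<in> {0..1}. f i s = f j s})"
  have T_iff: "s \<in> T \<longleftrightarrow> s \<in> {0..1} \<and> \<not> inj_on (\<lambda>i. f i s) I" for s
    unfolding T_def inj_on_def by auto
  have "closed {s \<in> {0..1}. f i s = f j s}" if "i \<in> I" "j \<in> I" for i j
  proof -
    have "closed {s \<in> {0..1}. dist (f i s) (f j s) = 0}"
      using that by (intro continuous_closed_preimage_constant continuous_intros cont) auto
    then show ?thesis by simp
  qed
  then have "closed T"
    unfolding T_def using \<open>finite I\<close> by (intro closed_UN ballI finite_Diff) auto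
  then have "compact T"
    using T_iff bounded_subset[of "{0..1::real}" T] by (simp add: compact_eq_bounded_closed subset_iff)
  moreover have "T \<noteq> {}" using assms T_iff by blast
  ultimately obtain t where t: "t \<in> T" and least: "\<And>s. s \<in> T \<Longrightarrow> t \<le> s"
    using compact_attains_inf by metis
  have "t \<noteq> 0" using t start T_iff by metis
  then show thesis
  proof (intro that)
    show "inj_on (\<lambda>i. f i s) I" if "0 \<le> s" "s < t" for s
      using that t least[of s] T_iff[of s] T_iff[of t] by auto
  qed (use t T_iff in auto)
qed

locale weighted_length_space = length_space adm len + weighted \<omega>
  for adm :: "real \<Rightarrow> real \<Rightarrow> (real \<Rightarrow> 'a::metric_space) \<Rightarrow> bool"
    and len :: "real \<Rightarrow> real \<Rightarrow> (real \<Rightarrow> 'a) \<Rightarrow> real"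
    and \<omega> :: "nat \<Rightarrow> real"
begin

lemma dist_le_len:
  assumes "adm a b \<gamma>"
  shows "dist (\<gamma> a) (\<gamma> b) \<le> len a b \<gamma>"
proof -
  have "a \<le> b" using admissible_path[OF assms] by blast
  then have "\<gamma> a \<in> \<gamma> ` {a..b}" "\<gamma> b \<in> \<gamma> ` {a..b}" by auto
  then have "length_dist adm len (\<gamma> a) (\<gamma> b) \<le> ereal (len a b \<gamma>)"
    unfolding length_dist_def using assms by (intro Inf_lower CollectI) blast
  then show ?thesis by (simp flip: dist_eq)
qed

text \<open>
  By affine invariance, the restrictions of a constant path to the two halves of \<open>[0, 1]\<close> have the
  same length as the whole, so additivity leaves only the value 0.
\<close>
lemma len_const: "len 0 1 (\<lambda>_. x) = 0"
proof -
  have adm: "adm 0 1 (\<lambda>_. x)" by (rule admissible_const) simp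
  have "bij_betw (\<lambda>t. 2 * t + 0) {0..1/2} {0..1::real}"
    using bij_betw_affine[of 2 0 0 "1/2"] by simp
  from length_affine[OF adm _ this] have "len 0 1 (\<lambda>_. x) = len 0 (1/2) (\<lambda>_. x)" by simp
  moreover have "bij_betw (\<lambda>t. 2 * t + (- 1)) {1/2..1} {0..1::real}"
    using bij_betw_affine[of 2 "-1" "1/2" 1] by simp
  from length_affine[OF adm _ this] have "len 0 1 (\<lambda>_. x) = len (1/2) 1 (\<lambda>_. x)" by simp
  ultimately show ?thesis
    using length_split[OF adm, of "1/2"] by simp
qed

text \<open>
  The parameter interval of the given geodesic can be a single point when \<^term>\<open>x = y\<close>; a
  constant path replaces it in that case.
\<close>
lemma unit_geodesic:
  assumes "\<exists>a b \<gamma>. adm a b \<gamma> \<and> \<gamma> a = x \<and> \<gamma> b = y \<and> len a b \<gamma> = dist x y"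
  shows "\<exists>\<gamma>. adm 0 1 \<gamma> \<and> \<gamma> 0 = x \<and> \<gamma> 1 = y \<and> len 0 1 \<gamma> = dist x y"
proof (cases "x = y")
  case True
  then show ?thesis
    using admissible_const[of 0 1 x] len_const[of x] by auto
next
  case False
  obtain a b \<gamma> where g: "adm a b \<gamma>" "\<gamma> a = x" "\<gamma> b = y" "len a b \<gamma> = dist x y"
    using assms by blast
  then have "a < b"
    using False admissible_path[OF g(1)] by (auto simp: less_le)
  let ?\<delta> = "\<lambda>t. \<gamma> ((b - a) * t + a)"
  have bij: "bij_betw (\<lambda>t. (b - a) * t + a) {0..1} {a..b}"
    using bij_betw_affine[of "b - a" a 0 1] \<open>a < b\<close> by simp
  have "adm 0 1 ?\<delta>" "len 0 1 ?\<delta> = dist x y"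
    using iffD1[OF admissible_affine[OF _ _ bij] g(1)] length_affine[OF g(1) _ bij] g(4) \<open>a < b\<close>
    by simp_all
  then show ?thesis
    using g by (intro exI[of _ ?\<delta>]) auto
qed

text \<open>
  An initial segment of a geodesic, rescaled to \<open>[0, 1]\<close>: what is left of the geodesic is at least as
  long as the distance it covers.
\<close>
lemma initial_segment:
  assumes g: "adm 0 1 \<gamma>" "len 0 1 \<gamma> = dist (\<gamma> 0) (\<gamma> 1)" and t: "0 < t" "t \<le> 1"
  shows "adm 0 1 (\<lambda>s. \<gamma> (t * s))"
    and "len 0 1 (\<lambda>s. \<gamma> (t * s)) + dist (\<gamma> t) (\<gamma> 1) \<le> dist (\<gamma> 0) (\<gamma> 1)"
proof -
  have bij: "bij_betw (\<lambda>s. t * s + 0) {0..1} {0..t}"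
    using bij_betw_affine[OF t(1), of 0 0 1] by simp
  have cont: "continuous_on {0..1} \<gamma>" using admissible_path[OF g(1)] by blast
  have "adm 0 t \<gamma> \<and> adm t 1 \<gamma>"
    by (rule iffD1[OF admissible_split[OF cont] g(1)]) (use t in auto)
  then have split: "adm 0 t \<gamma>" "adm t 1 \<gamma>" by auto
  have "adm 0 1 (\<lambda>s. \<gamma> (t * s + 0))"
    by (rule iffD1[OF admissible_affine[OF _ _ bij] split(1)]) (use t in auto)
  then show "adm 0 1 (\<lambda>s. \<gamma> (t * s))" by simp
  have "len 0 1 (\<lambda>s. \<gamma> (t * s)) = len 0 t \<gamma>"
    using length_affine[OF split(1) _ bij] by simp
  then show "len 0 1 (\<lambda>s. \<gamma> (t * s)) + dist (\<gamma> t) (\<gamma> 1) \<le> dist (\<gamma> 0) (\<gamma> 1)"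
    using dist_le_len[OF split(2)] length_split[OF g(1), of t] g(2) t by linarith
qed

lemma reverse_path:
  assumes "adm 0 1 \<gamma>"
  shows "adm 0 1 (\<lambda>s. \<gamma> (1 - s))" "len 0 1 (\<lambda>s. \<gamma> (1 - s)) = len 0 1 \<gamma>"
proof -
  have "(\<lambda>s. \<gamma> (1 - s)) = (\<lambda>s. \<gamma> (- 1 * s + 1))" by (simp add: algebra_simps)
  then show "adm 0 1 (\<lambda>s. \<gamma> (1 - s))" "len 0 1 (\<lambda>s. \<gamma> (1 - s)) = len 0 1 \<gamma>"
    using iffD1[OF admissible_affine[OF _ _ bij_betw_reflect] assms]
      length_affine[OF assms _ bij_betw_reflect] by simp_all
qed

lemma shift_path:
  assumes "adm 0 1 \<gamma>"
  shows "adm r (r + 1) (\<lambda>s. \<gamma> (s - r))" "len r (r + 1) (\<lambda>s. \<gamma> (s - r)) = len 0 1 \<gamma>"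
proof -
  have bij: "bij_betw (\<lambda>s. 1 * s + - r) {r..r + 1} {0..1}"
    using bij_betw_affine[of 1 "- r" r "r + 1"] by simp
  show "adm r (r + 1) (\<lambda>s. \<gamma> (s - r))" "len r (r + 1) (\<lambda>s. \<gamma> (s - r)) = len 0 1 \<gamma>"
    using iffD1[OF admissible_affine[OF _ _ bij] assms]
      length_affine[OF assms _ bij] by simp_all
qed

section \<open>Chains of pieces with a valley of cardinalities\<close>

text \<open>
  A motion of \<^term>\<open>n\<close> points that are distinct at interior times; they may coincide at the two end
  times.
\<close>
definition piece :: "nat \<Rightarrow> (nat \<Rightarrow> real \<Rightarrow> 'a) \<Rightarrow> 'a set \<Rightarrow> 'a set \<Rightarrow> bool" where
  "piece n \<gamma> A B \<longleftrightarrow> 1 \<le> n \<and> (\<forall>j<n. adm 0 1 (\<gamma> j))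
    \<and> (\<lambda>j. \<gamma> j 0) ` {..<n} = A \<and> (\<lambda>j. \<gamma> j 1) ` {..<n} = B
    \<and> (\<forall>s\<in>{0<..<1}. inj_on (\<lambda>j. \<gamma> j s) {..<n})"

definition piece_length :: "nat \<Rightarrow> (nat \<Rightarrow> real \<Rightarrow> 'a) \<Rightarrow> real" where
  "piece_length n \<gamma> = \<omega> n * (\<Sum>j<n. len 0 1 (\<gamma> j))"

text \<open>
  A chain of \<^term>\<open>k\<close> pieces through the configurations \<open>Z 0, ..., Z k\<close>.  Collisions happen only at
  the end of each of the first \<^term>\<open>m\<close> pieces and only at the start of each of the others.  As the
  configurations at the ends of a piece have at most as many points as the piece, the cardinality
  decreases up to \<open>Z m\<close> and increases from there.
\<close>
definition valley :: "'a set \<Rightarrow> 'a set \<Rightarrow> nat \<Rightarrow> nat \<Rightarrow> (nat \<Rightarrow> 'a set) \<Rightarrow> (nat \<Rightarrow> nat)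
    \<Rightarrow> (nat \<Rightarrow> nat \<Rightarrow> real \<Rightarrow> 'a) \<Rightarrow> bool" where
  "valley X Y k m Z n \<gamma> \<longleftrightarrow> m \<le> k \<and> Z 0 = X \<and> Z k = Y
    \<and> (\<forall>i<k. piece (n i) (\<gamma> i) (Z i) (Z (Suc i)))
    \<and> (\<forall>i<m. card (Z i) = n i) \<and> (\<forall>i<k. m \<le> i \<longrightarrow> card (Z (Suc i)) = n i)"

definition joined :: "'a set \<Rightarrow> 'a set \<Rightarrow> real \<Rightarrow> bool" where
  "joined X Y c \<longleftrightarrow>
    (\<exists>k m Z n \<gamma>. valley X Y k m Z n \<gamma> \<and> (\<Sum>i<k. piece_length (n i) (\<gamma> i)) \<le> c)"

lemma joined_refl: "joined X X 0"
  unfolding joined_def valley_def by (intro exI[of _ 0] exI[of _ "\<lambda>_. X"]) auto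

text \<open>
  A piece without collision at its start can be put in front of every valley.  Together with
  \<open>joined_commute\<close> below this also allows appending a piece without collision at its end.
\<close>
lemma joined_prepend:
  assumes "piece n0 \<gamma>0 X X'" "card X = n0" "joined X' Y c" "piece_length n0 \<gamma>0 + c \<le> d"
  shows "joined X Y d"
proof -
  obtain k m Z n \<gamma> where v: "valley X' Y k m Z n \<gamma>" "(\<Sum>i<k. piece_length (n i) (\<gamma> i)) \<le> c"
    using assms(3) unfolding joined_def by blast
  have "valley X Y (Suc k) (Suc m) (case_nat X Z) (case_nat n0 n) (case_nat \<gamma>0 \<gamma>)"
    unfolding valley_def
  proof (intro conjI allI impI)
    fix i assume "i < Suc k"
    then show "piece (case_nat n0 n i) (case_nat \<gamma>0 \<gamma> i) (case_nat X Z i) (case_nat X Z (Suc i))"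
      using v(1) assms(1) unfolding valley_def by (cases i) auto
  next
    fix i assume "i < Suc m"
    then show "card (case_nat X Z i) = case_nat n0 n i"
      using v(1) assms(2) unfolding valley_def by (cases i) auto
  next
    fix i assume "i < Suc k" "Suc m \<le> i"
    then show "card (case_nat X Z (Suc i)) = case_nat n0 n i"
      using v(1) unfolding valley_def by (cases i) auto
  qed (use v(1) in \<open>auto simp: valley_def\<close>)
  moreover have "(\<Sum>i<Suc k. piece_length (case_nat n0 n i) (case_nat \<gamma>0 \<gamma> i)) \<le> d"
    unfolding sum.lessThan_Suc_shift using v(2) assms(4) by simp
  ultimately show ?thesis unfolding joined_def by blast
qed

lemma piece_reverse:
  assumes "piece n \<gamma> A B"
  shows "piece n (\<lambda>j s. \<gamma> j (1 - s)) B A"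
    "piece_length n (\<lambda>j s. \<gamma> j (1 - s)) = piece_length n \<gamma>"
proof -
  have "\<forall>j<n. adm 0 1 (\<lambda>s. \<gamma> j (1 - s))"
    using assms reverse_path(1) unfolding piece_def by blast
  moreover have "inj_on (\<lambda>j. \<gamma> j (1 - s)) {..<n}" if "s \<in> {0<..<1}" for s
    using assms that unfolding piece_def by simp
  ultimately show "piece n (\<lambda>j s. \<gamma> j (1 - s)) B A"
    using assms unfolding piece_def by simp
  have "len 0 1 (\<lambda>s. \<gamma> j (1 - s)) = len 0 1 (\<gamma> j)" if "j < n" for j
    by (rule reverse_path(2)) (use assms that in \<open>simp add: piece_def\<close>)
  then show "piece_length n (\<lambda>j s. \<gamma> j (1 - s)) = piece_length n \<gamma>"
    unfolding piece_length_def by simp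
qed

lemma joined_commute:
  assumes "joined X Y c"
  shows "joined Y X c"
proof -
  obtain k m Z n \<gamma> where v: "valley X Y k m Z n \<gamma>" "(\<Sum>i<k. piece_length (n i) (\<gamma> i)) \<le> c"
    using assms unfolding joined_def by blast
  have "valley Y X k (k - m) (\<lambda>i. Z (k - i)) (\<lambda>i. n (k - Suc i))
      (\<lambda>i j s. \<gamma> (k - Suc i) j (1 - s))"
    unfolding valley_def
  proof (intro conjI allI impI)
    fix i assume "i < k"
    then have "piece (n (k - Suc i)) (\<gamma> (k - Suc i)) (Z (k - Suc i)) (Z (Suc (k - Suc i)))"
      using v(1) unfolding valley_def by (metis diff_Suc_less le_less_trans le0)
    then show "piece (n (k - Suc i)) (\<lambda>j s. \<gamma> (k - Suc i) j (1 - s)) (Z (k - i)) (Z (k - Suc i))"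
      using piece_reverse(1) \<open>i < k\<close> by (simp add: Suc_diff_Suc)
  next
    fix i assume "i < k - m"
    then have "card (Z (Suc (k - Suc i))) = n (k - Suc i)"
      using v(1) unfolding valley_def by simp
    then show "card (Z (k - i)) = n (k - Suc i)"
      using \<open>i < k - m\<close> by (simp add: Suc_diff_Suc)
  next
    fix i assume "i < k" "k - m \<le> i"
    then show "card (Z (k - Suc i)) = n (k - Suc i)"
      using v(1) unfolding valley_def by simp
  qed (use v(1) in \<open>auto simp: valley_def\<close>)
  moreover have "piece_length (n (k - Suc i)) (\<lambda>j s. \<gamma> (k - Suc i) j (1 - s))
      = piece_length (n (k - Suc i)) (\<gamma> (k - Suc i))" if "i < k" for i
  proof (rule piece_reverse(2))
    show "piece (n (k - Suc i)) (\<gamma> (k - Suc i)) (Z (k - Suc i)) (Z (Suc (k - Suc i)))"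
      using v(1) that unfolding valley_def by simp
  qed
  then have "(\<Sum>i<k. piece_length (n (k - Suc i)) (\<lambda>j s. \<gamma> (k - Suc i) j (1 - s))) \<le> c"
    using v(2) sum.nat_diff_reindex[of "\<lambda>i. piece_length (n i) (\<gamma> i)" k] by simp
  ultimately show ?thesis
    unfolding joined_def by (intro exI conjI)
qed

text \<open>
  The heart of the construction.  The geodesic motion towards \<^term>\<open>F ` X\<close> is stopped at the
  first collision, and optimality survives: from the configuration \<open>X'\<close> reached there, the
  remaining parts of the geodesics lead to \<^term>\<open>F ` X\<close>, as a relation with at most
  \<^term>\<open>card X\<close> edges, hence with no larger weight than before.
\<close>
lemma optimal_initial_piece:
  assumes geodesic: "\<And>x y :: 'a. \<exists>a b \<gamma>. adm a b \<gamma> \<and> \<gamma> a = x \<and> \<gamma> b = y \<and> len a b \<gamma> = dist x y"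
    and X: "X \<in> Ran" and Y: "Y \<in> Ran"
    and opt: "move F X + ran_dist \<omega> (F ` X) Y \<le> ran_dist \<omega> X Y"
  obtains \<gamma> X' where "piece (card X) \<gamma> X X'" "X' \<in> Ran"
    "piece_length (card X) \<gamma> + ran_dist \<omega> X' Y \<le> ran_dist \<omega> X Y"
    "card X' < card X \<or> inj_on F X \<and> X' = F ` X"
proof -
  note result = that
  let ?n = "card X"
  have n: "1 \<le> ?n" using Ran_card[OF X] .
  then have ne: "{..<?n} \<noteq> {}" by (auto simp: lessThan_empty_iff)
  obtain e where e: "bij_betw e {..<?n} X"
    using ex_bij_betw_nat_finite[of X] X by (auto simp: Ran_def atLeast0LessThan)
  have img: "e ` {..<?n} = X" and inj: "inj_on e {..<?n}"
    using e by (auto simp: bij_betw_def)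
  have "\<forall>j. \<exists>\<gamma>. adm 0 1 \<gamma> \<and> \<gamma> 0 = e j \<and> \<gamma> 1 = F (e j) \<and> len 0 1 \<gamma> = dist (e j) (F (e j))"
    using unit_geodesic[OF geodesic] by blast
  from choice[OF this] obtain g where
    "\<forall>j. adm 0 1 (g j) \<and> g j 0 = e j \<and> g j 1 = F (e j) \<and> len 0 1 (g j) = dist (e j) (F (e j))"
    by (rule exE)
  then have g: "\<And>j. adm 0 1 (g j)" "\<And>j. g j 0 = e j" "\<And>j. g j 1 = F (e j)"
    "\<And>j. len 0 1 (g j) = dist (e j) (F (e j))"
    by simp_all
  \<comment> \<open>Stop at time \<open>t\<close>, which is either the first collision or the end of a motion without
    collisions.\<close>
  have step: thesis
    if t: "0 < t" "t \<le> 1" and free: "\<And>s. 0 \<le> s \<Longrightarrow> s < t \<Longrightarrow> inj_on (\<lambda>j. g j s) {..<?n}"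
      and stop: "card ((\<lambda>j. g j t) ` {..<?n}) < ?n \<or> inj_on F X \<and> t = 1" for t
  proof -
    let ?\<gamma> = "\<lambda>j s. g j (t * s)" and ?X' = "(\<lambda>j. g j t) ` {..<?n}"
    have seg: "adm 0 1 (?\<gamma> j)" "len 0 1 (?\<gamma> j) + dist (g j t) (F (e j)) \<le> dist (e j) (F (e j))" for j
      using initial_segment[of "g j" t] g t by auto
    have X': "?X' \<in> Ran" using ne by (auto intro: RanI)
    have FX: "F ` X = (\<lambda>j. F (e j)) ` {..<?n}" using image_image[of F e "{..<?n}"] img by simp
    have "piece_length ?n ?\<gamma> + \<omega> ?n * (\<Sum>j<?n. dist (g j t) (F (e j)))
        = \<omega> ?n * (\<Sum>j<?n. len 0 1 (?\<gamma> j) + dist (g j t) (F (e j)))"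
      unfolding piece_length_def by (simp add: sum.distrib distrib_left)
    also have "\<dots> \<le> \<omega> ?n * (\<Sum>j<?n. dist (e j) (F (e j)))"
      using weight_ge_1[OF n] by (intro mult_left_mono sum_mono seg) auto
    also have "\<dots> = move F X"
      unfolding move_def using sum.reindex_bij_betw[OF e, of "\<lambda>x. dist x (F x)"] by simp
    finally have "piece_length ?n ?\<gamma> + ran_dist \<omega> ?X' (F ` X) \<le> move F X"
      using ran_dist_image_le[of "{..<?n}" "\<lambda>j. g j t" "\<lambda>j. F (e j)"] ne unfolding FX by simp
    then have len: "piece_length ?n ?\<gamma> + ran_dist \<omega> ?X' Y \<le> ran_dist \<omega> X Y"
      using ran_dist_triangle[OF X' Ran_image[OF X] Y, of F] opt by linarith
    have piece: "piece ?n ?\<gamma> X ?X'"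
      unfolding piece_def
    proof (intro conjI ballI)
      fix s :: real assume "s \<in> {0<..<1}"
      then have "0 \<le> t * s" "t * s < t" using t by auto
      then show "inj_on (\<lambda>j. g j (t * s)) {..<?n}" by (rule free)
    next
      show "(\<lambda>j. g j (t * 0)) ` {..<?n} = X" using g(2) img by simp
    qed (use n seg(1) in auto)
    have "card ?X' < card X \<or> inj_on F X \<and> ?X' = F ` X"
      using stop FX g(3) by auto
    then show thesis by (rule result[OF piece X' len])
  qed
  show thesis
  proof (cases "\<exists>u\<in>{0..1}. \<not> inj_on (\<lambda>j. g j u) {..<?n}")
    case True
    then obtain u where u: "u \<in> {0..1}" "\<not> inj_on (\<lambda>j. g j u) {..<?n}" by blast
    have "continuous_on {0..1} (g j)" for j using admissible_path[OF g(1)] by blast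
    moreover have "inj_on (\<lambda>j. g j 0) {..<?n}" using inj g(2) by simp
    ultimately obtain t where t: "0 < t" "t \<le> 1" "\<not> inj_on (\<lambda>j. g j t) {..<?n}"
      "\<And>s. 0 \<le> s \<Longrightarrow> s < t \<Longrightarrow> inj_on (\<lambda>j. g j s) {..<?n}"
      using first_collision[of "{..<?n}" g u] u by auto
    have "card ((\<lambda>j. g j t) ` {..<?n}) \<noteq> ?n"
      using t(3) eq_card_imp_inj_on[of "{..<?n}" "\<lambda>j. g j t"] by auto
    then have "card ((\<lambda>j. g j t) ` {..<?n}) < ?n"
      using card_image_le[of "{..<?n}" "\<lambda>j. g j t"] by auto
    then show thesis using t by (intro step[of t]) auto
  next
    case False
    then have "inj_on (\<lambda>j. g j 1) {..<?n}" by simp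
    then have "inj_on (\<lambda>j. F (e j)) {..<?n}" unfolding g(3) .
    then have "inj_on F X" using img inj_on_imageI[of F e "{..<?n}"] by (simp add: comp_def)
    then show thesis using False by (intro step[of 1]) auto
  qed
qed

text \<open>
  Induction on the total number of points.  Either the initial piece has fewer points at its end, or
  it comes from a bijection and already reaches the goal.
\<close>
lemma joined_optimally:
  assumes heine_borel: "\<And>S :: 'a set. closed S \<Longrightarrow> bounded S \<Longrightarrow> compact S"
    and geodesic: "\<And>x y :: 'a. \<exists>a b \<gamma>. adm a b \<gamma> \<and> \<gamma> a = x \<and> \<gamma> b = y \<and> len a b \<gamma> = dist x y"
    and "X \<in> Ran" "Y \<in> Ran"
  shows "joined X Y (ran_dist \<omega> X Y)"
  using assms(3,4)
proof (induction "card X + card Y" arbitrary: X Y rule: less_induct)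
  case less
  have merge: "joined A B (ran_dist \<omega> A B)"
    if opt: "move F A + ran_dist \<omega> (F ` A) B \<le> ran_dist \<omega> A B" and F: "inj_on F A \<Longrightarrow> F ` A = B"
      and A: "A \<in> Ran" and B: "B \<in> Ran"
      and IH: "\<And>A'. card A' < card A \<Longrightarrow> A' \<in> Ran \<Longrightarrow> joined A' B (ran_dist \<omega> A' B)"
    for A B F
  proof -
    obtain \<gamma> A' where p: "piece (card A) \<gamma> A A'" "A' \<in> Ran"
      "piece_length (card A) \<gamma> + ran_dist \<omega> A' B \<le> ran_dist \<omega> A B"
      "card A' < card A \<or> inj_on F A \<and> A' = F ` A"
      by (rule optimal_initial_piece[OF geodesic A B opt])
    have "joined A' B (ran_dist \<omega> A' B)"
      using p(4) F IH[OF _ p(2)] joined_refl[of B] ran_dist_self[OF B] by auto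
    then show ?thesis using joined_prepend[OF p(1)] p(3) by blast
  qed
  have X_merge: "joined X Y (ran_dist \<omega> X Y)"
    if "move F X + ran_dist \<omega> (F ` X) Y \<le> ran_dist \<omega> X Y" "inj_on F X \<Longrightarrow> F ` X = Y" for F
    by (rule merge[OF that less.prems]) (auto intro!: less.hyps less.prems(2))
  have sym: "ran_dist \<omega> X Y = ran_dist \<omega> Y X" by (rule ran_dist_commute[OF less.prems])
  consider (bijection) F where "bij_betw F X Y" "move F X \<le> ran_dist \<omega> X Y"
    | (left) F where "\<not> inj_on F X" "move F X + ran_dist \<omega> (F ` X) Y \<le> ran_dist \<omega> X Y"
    | (right) F where "\<not> inj_on F Y" "move F Y + ran_dist \<omega> (F ` Y) X \<le> ran_dist \<omega> X Y"
    using optimal_first_step[OF _ less.prems] heine_borel by blast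
  then show ?case
  proof cases
    case (bijection F)
    then have "F ` X = Y" by (simp add: bij_betw_def)
    then show ?thesis
      using ran_dist_self[OF less.prems(2)] bijection(2) by (intro X_merge[of F]) simp_all
  next
    case (left F)
    show ?thesis by (rule X_merge[OF left(2)]) (use left(1) in simp)
  next
    case (right F)
    have "joined Y X (ran_dist \<omega> Y X)"
    proof (rule merge)
      show "move F Y + ran_dist \<omega> (F ` Y) X \<le> ran_dist \<omega> Y X" using right(2) sym by simp
      show "F ` Y = X" if "inj_on F Y" using right(1) that by simp
      fix Y' :: "'a set" assume Y': "card Y' < card Y" "Y' \<in> Ran"
      then have "joined X Y' (ran_dist \<omega> X Y')"
        by (intro less.hyps less.prems) simp_all
      then show "joined Y' X (ran_dist \<omega> Y' X)"
        unfolding ran_dist_commute[OF less.prems(1) Y'(2)] by (rule joined_commute)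
    qed (rule less.prems)+
    then show ?thesis unfolding sym by (rule joined_commute)
  qed
qed

end

section \<open>Lifts and lengths\<close>
lemma subdivision_mono:
  assumes "subdivision a b k t" "i \<le> j" "j \<le> k"
  shows "t i \<le> t j"
  using assms(2,3)
proof (induction j rule: dec_induct)
  case (step j)
  have "t j < t (Suc j)" using assms(1) step unfolding subdivision_def by simp
  then show ?case using step by simp
qed simp

text \<open>
  The relation is a parameter because cardinalities decrease on one side of the valley and
  increase on the other.
\<close>
lemma monotone_on_unit_pieces:
  fixes f :: "real \<Rightarrow> 'b"
  assumes "transp R" "reflp R"
    and piece: "\<And>i. l \<le> i \<Longrightarrow> i < u \<Longrightarrow> monotone_on {real i..real (Suc i)} (\<le>) R f"
    and "l \<le> u"
  shows "monotone_on {real l..real u} (\<le>) R f"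
  using \<open>l \<le> u\<close> piece
proof (induction u rule: dec_induct)
  case base
  then show ?case using \<open>reflp R\<close> by (auto simp: monotone_on_def reflp_def)
next
  case (step u)
  have lo: "monotone_on {real l..real u} (\<le>) R f" using step by simp
  have hi: "monotone_on {real u..real (Suc u)} (\<le>) R f" using step by simp
  show ?case
  proof (rule monotone_onI)
    fix x y assume xy: "x \<in> {real l..real (Suc u)}" "y \<in> {real l..real (Suc u)}" "x \<le> y"
    have lu: "real l \<le> real u" using step by simp
    consider "y \<le> real u" | "real u \<le> x" | "x \<le> real u" "real u \<le> y" by linarith
    then show "R (f x) (f y)"
    proof cases
      case 1
      then show ?thesis using xy lo by (auto intro: monotone_onD)
    next
      case 2
      then show ?thesis using xy hi by (auto intro: monotone_onD)
    next
      case 3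
      have "R (f x) (f (real u))" using 3 xy lu by (intro monotone_onD[OF lo]) auto
      moreover have "R (f (real u)) (f y)" using 3 xy by (intro monotone_onD[OF hi]) auto
      ultimately show ?thesis using \<open>transp R\<close> by (blast dest: transpD)
    qed
  qed
qed

context weighted begin

text \<open>
  On each interval of the subdivision, \<^term>\<open>\<Gamma>\<close> moves in \<^term>\<open>ran_dist \<omega>\<close> by at most a multiple of
  the total displacement of the components of the lift.
\<close>
lemma ran_path_of_lift:
  fixes \<Gamma> :: "real \<Rightarrow> 'a::metric_space set"
  assumes lift: "ran_lift a b \<Gamma> k t n \<gamma>" and start: "\<Gamma> a \<in> Ran"
  shows "ran_path \<omega> a b \<Gamma>"
proof -
  have sub: "subdivision a b k t" using lift unfolding ran_lift_def by blast
  have ends: "t 0 = a" "t k = b" using sub unfolding subdivision_def by auto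
  have "(\<forall>x\<in>{a..t m}. \<Gamma> x \<in> Ran)
      \<and> (\<forall>x. ((\<lambda>s. ran_dist \<omega> (\<Gamma> s) (\<Gamma> x)) \<longlongrightarrow> 0) (at x within {a..t m}))"
    if "m \<le> k" for m
    using that
  proof (induction m)
    case 0
    have "at x within {a} = bot" for x
      using islimpt_finite[of "{a}" x] by (simp add: trivial_limit_within)
    then show ?case using start ends by simp
  next
    case (Suc m)
    let ?J = "{t m..t (Suc m)}"
    have n: "1 \<le> n m" and cont: "\<And>j. j < n m \<Longrightarrow> continuous_on ?J (\<gamma> m j)"
      and \<Gamma>: "\<And>s. s \<in> ?J \<Longrightarrow> \<Gamma> s = (\<lambda>j. \<gamma> m j s) ` {..<n m}"
      using lift Suc.prems unfolding ran_lift_def by (auto simp: less_eq_Suc_le)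
    have ne: "{..<n m} \<noteq> {}" using n by (auto simp: lessThan_empty_iff)
    have J_Ran: "\<Gamma> s \<in> Ran" if "s \<in> ?J" for s
      unfolding \<Gamma>[OF that] using ne by (intro RanI) auto
    have J_lim: "((\<lambda>s. ran_dist \<omega> (\<Gamma> s) (\<Gamma> x)) \<longlongrightarrow> 0) (at x within ?J)" for x
    \<comment> \<open>Outside the closed interval \<open>?J\<close> the filter is trivial, so the limit can be claimed for
      every \<open>x\<close> and the intervals can be glued.\<close>
    proof (cases "x \<in> ?J")
      case False
      then have "at x within ?J = bot"
        using closed_atLeastAtMost[of "t m" "t (Suc m)"] unfolding trivial_limit_within closed_limpt
        by blast
      then show ?thesis by simp
    next
      case True
      let ?g = "\<lambda>s. \<omega> (n m) * (\<Sum>j<n m. dist (\<gamma> m j s) (\<gamma> m j x))"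
      show ?thesis
      proof (rule tendsto_sandwich)
        have "0 \<le> ran_dist \<omega> (\<Gamma> s) (\<Gamma> x)" if "s \<in> ?J" for s
          by (rule ran_dist_nonneg[OF J_Ran[OF that] J_Ran[OF True]])
        then show "\<forall>\<^sub>F s in at x within ?J. 0 \<le> ran_dist \<omega> (\<Gamma> s) (\<Gamma> x)"
          unfolding eventually_at_filter by (intro always_eventually) blast
        have "ran_dist \<omega> (\<Gamma> s) (\<Gamma> x) \<le> ?g s" if "s \<in> ?J" for s
          unfolding \<Gamma>[OF that] \<Gamma>[OF True]
          using ran_dist_image_le[of "{..<n m}" "\<lambda>j. \<gamma> m j s" "\<lambda>j. \<gamma> m j x"] ne by simp
        then show "\<forall>\<^sub>F s in at x within ?J. ran_dist \<omega> (\<Gamma> s) (\<Gamma> x) \<le> ?g s"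
          unfolding eventually_at_filter by (intro always_eventually) blast
        have "((\<lambda>s. \<gamma> m j s) \<longlongrightarrow> \<gamma> m j x) (at x within ?J)" if "j < n m" for j
          using cont[OF that] True by (simp add: continuous_on_def)
        then have "(?g \<longlongrightarrow> \<omega> (n m) * (\<Sum>j<n m. dist (\<gamma> m j x) (\<gamma> m j x))) (at x within ?J)"
          by (intro tendsto_intros) auto
        then show "(?g \<longlongrightarrow> 0) (at x within ?J)" by simp
      qed simp
    qed
    have "a \<le> t m" "t m \<le> t (Suc m)"
      using subdivision_mono[OF sub, of 0 m] subdivision_mono[OF sub, of m "Suc m"] Suc.prems ends
      by auto
    then have union: "{a..t (Suc m)} = {a..t m} \<union> ?J" by auto
    have "m \<le> k" using Suc.prems by simp
    from Suc.IH[OF this] show ?case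
      unfolding union using J_Ran J_lim by (auto intro: Lim_Un)
  qed
  from this[of k] show ?thesis
    unfolding ran_path_def using subdivision_mono[OF sub, of 0 k] ends by auto
qed

end

context weighted_length_space begin

text \<open>
  Sampling a lift at its subdivision points gives a chain of relations that is not longer than the
  lift.
\<close>
lemma ran_dist_le_lift_length:
  assumes lift: "admissible_lift adm a b \<Gamma> k t n \<gamma>" and start: "\<Gamma> a \<in> Ran"
  shows "ran_dist \<omega> (\<Gamma> a) (\<Gamma> b) \<le> lift_length len \<omega> k t n \<gamma>"
proof -
  have rl: "ran_lift a b \<Gamma> k t n \<gamma>" and adm: "\<And>i j. i < k \<Longrightarrow> j < n i \<Longrightarrow> adm (t i) (t (Suc i)) (\<gamma> i j)"
    using lift unfolding admissible_lift_def by auto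
  have sub: "subdivision a b k t" using rl unfolding ran_lift_def by blast
  have ends: "t 0 = a" "t k = b" using sub unfolding subdivision_def by auto
  have "\<Gamma> (t i) \<in> Ran \<and> ran_dist \<omega> (\<Gamma> a) (\<Gamma> (t i))
      \<le> (\<Sum>i<i. \<omega> (n i) * (\<Sum>j<n i. len (t i) (t (Suc i)) (\<gamma> i j)))" if "i \<le> k" for i
    using that
  proof (induction i)
    case 0
    then show ?case using start ends ran_dist_self[OF start] by simp
  next
    case (Suc i)
    then have IH: "\<Gamma> (t i) \<in> Ran" "ran_dist \<omega> (\<Gamma> a) (\<Gamma> (t i))
      \<le> (\<Sum>i<i. \<omega> (n i) * (\<Sum>j<n i. len (t i) (t (Suc i)) (\<gamma> i j)))" and i: "i < k" by auto
    have n: "1 \<le> n i"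
      and img: "\<And>s. s \<in> {t i..t (Suc i)} \<Longrightarrow> \<Gamma> s = (\<lambda>j. \<gamma> i j s) ` {..<n i}"
      using rl i unfolding ran_lift_def by auto
    have le: "t i \<le> t (Suc i)" using subdivision_mono[OF sub, of i "Suc i"] i by simp
    have ne: "{..<n i} \<noteq> {}" using n by (auto simp: lessThan_empty_iff)
    have \<Gamma>: "\<Gamma> (t i) = (\<lambda>j. \<gamma> i j (t i)) ` {..<n i}"
      "\<Gamma> (t (Suc i)) = (\<lambda>j. \<gamma> i j (t (Suc i))) ` {..<n i}"
      using le by (auto intro!: img)
    have Ran: "\<Gamma> (t (Suc i)) \<in> Ran" unfolding \<Gamma> using ne by (intro RanI) auto
    have "ran_dist \<omega> (\<Gamma> (t i)) (\<Gamma> (t (Suc i)))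
        \<le> \<omega> (n i) * (\<Sum>j<n i. dist (\<gamma> i j (t i)) (\<gamma> i j (t (Suc i))))"
      unfolding \<Gamma> using ran_dist_image_le[of "{..<n i}" "\<lambda>j. \<gamma> i j (t i)"] ne by simp
    also have "\<dots> \<le> \<omega> (n i) * (\<Sum>j<n i. len (t i) (t (Suc i)) (\<gamma> i j))"
      using weight_ge_1[OF n] by (intro mult_left_mono sum_mono dist_le_len adm i) auto
    finally show ?case
      using IH Ran ran_dist_triangle[OF start IH(1) Ran] by simp
  qed
  from this[of k] show ?thesis unfolding lift_length_def ends by simp
qed

lemma ran_length_eq_ran_dist:
  assumes lift: "admissible_lift adm a b \<Gamma> k t n \<gamma>" and start: "\<Gamma> a \<in> Ran"
    and le: "lift_length len \<omega> k t n \<gamma> \<le> ran_dist \<omega> (\<Gamma> a) (\<Gamma> b)"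
  shows "ran_length adm len \<omega> a b \<Gamma> = ran_dist \<omega> (\<Gamma> a) (\<Gamma> b)"
proof (rule antisym)
  let ?L = "{lift_length len \<omega> k t n \<gamma> | k t n \<gamma>. admissible_lift adm a b \<Gamma> k t n \<gamma>}"
  have lower: "ran_dist \<omega> (\<Gamma> a) (\<Gamma> b) \<le> l" if "l \<in> ?L" for l
    using that ran_dist_le_lift_length[where \<Gamma> = \<Gamma> and a = a and b = b, OF _ start] by blast
  have mem: "lift_length len \<omega> k t n \<gamma> \<in> ?L" using lift by blast
  then have "Inf ?L \<le> lift_length len \<omega> k t n \<gamma>"
    using lower by (intro cInf_lower bdd_belowI)
  then show "ran_length adm len \<omega> a b \<Gamma> \<le> ran_dist \<omega> (\<Gamma> a) (\<Gamma> b)"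
    using le unfolding ran_length_def by (rule order_trans)
  show "ran_dist \<omega> (\<Gamma> a) (\<Gamma> b) \<le> ran_length adm len \<omega> a b \<Gamma>"
    unfolding ran_length_def using lower mem by (intro cInf_greatest) auto
qed

section \<open>The path of a valley\<close>

text \<open>
  The pieces are run one after the other, the \<open>i\<close>-th one on the interval \<open>[i, i + 1]\<close>.  At the
  final time \<open>k\<close> no piece is running any more, so the value is \<^term>\<open>Y\<close>; this also covers \<open>k = 0\<close>.
\<close>
definition valley_path :: "'a set \<Rightarrow> nat \<Rightarrow> (nat \<Rightarrow> nat) \<Rightarrow> (nat \<Rightarrow> nat \<Rightarrow> real \<Rightarrow> 'a) \<Rightarrow> real \<Rightarrow> 'a set"
  where "valley_path Y k n \<gamma> s =
    (let i = nat \<lfloor>s\<rfloor> in if i < k then (\<lambda>j. \<gamma> i j (s - real i)) ` {..<n i} else Y)"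

lemma valley_path_nat:
  assumes "valley X Y k m Z n \<gamma>" "i \<le> k"
  shows "valley_path Y k n \<gamma> (real i) = Z i"
  using assms unfolding valley_path_def valley_def piece_def by (auto simp: Let_def)

lemma valley_path_piece:
  assumes "valley X Y k m Z n \<gamma>" "i < k" "s \<in> {real i..real (Suc i)}"
  shows "valley_path Y k n \<gamma> s = (\<lambda>j. \<gamma> i j (s - real i)) ` {..<n i}"
proof (cases "s = real (Suc i)")
  case True
  have "Z (Suc i) = (\<lambda>j. \<gamma> i j 1) ` {..<n i}"
    using assms unfolding valley_def piece_def by auto
  then show ?thesis
    using valley_path_nat[OF assms(1), of "Suc i"] assms(2) True by simp
next
  case False
  then have "nat \<lfloor>s\<rfloor> = i" using assms(3) by (simp add: floor_eq_iff nat_eq_iff)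
  then show ?thesis using assms(2) unfolding valley_path_def by simp
qed

lemma valley_card:
  assumes v: "valley X Y k m Z n \<gamma>" and i: "i < k"
  shows "s \<in> {real i<..<real (Suc i)} \<Longrightarrow> card (valley_path Y k n \<gamma> s) = n i"
    and "card (Z i) \<le> n i" "card (Z (Suc i)) \<le> n i"
proof -
  have p: "piece (n i) (\<gamma> i) (Z i) (Z (Suc i))" using v i unfolding valley_def by blast
  show "card (valley_path Y k n \<gamma> s) = n i" if s: "s \<in> {real i<..<real (Suc i)}"
  proof -
    have "inj_on (\<lambda>j. \<gamma> i j (s - real i)) {..<n i}" using p s unfolding piece_def by auto
    then show ?thesis
      using valley_path_piece[OF v i, of s] s by (simp add: card_image)
  qed
  have "Z i = (\<lambda>j. \<gamma> i j 0) ` {..<n i}" "Z (Suc i) = (\<lambda>j. \<gamma> i j 1) ` {..<n i}"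
    using p unfolding piece_def by auto
  then show "card (Z i) \<le> n i" "card (Z (Suc i)) \<le> n i"
    using card_image_le[of "{..<n i}"] by (metis card_lessThan finite_lessThan)+
qed

lemma valley_path_lift:
  assumes v: "valley X Y k m Z n \<gamma>"
  shows "admissible_lift adm 0 (real k) (valley_path Y k n \<gamma>) k real n (\<lambda>i j s. \<gamma> i j (s - real i))"
    and "lift_length len \<omega> k real n (\<lambda>i j s. \<gamma> i j (s - real i)) = (\<Sum>i<k. piece_length (n i) (\<gamma> i))"
proof -
  have adm: "adm 0 1 (\<gamma> i j)" and n: "1 \<le> n i" if "i < k" "j < n i" for i j
    using v that unfolding valley_def piece_def by auto
  have shifted: "adm (real i) (real (Suc i)) (\<lambda>s. \<gamma> i j (s - real i))"
    "len (real i) (real (Suc i)) (\<lambda>s. \<gamma> i j (s - real i)) = len 0 1 (\<gamma> i j)"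
    if "i < k" "j < n i" for i j
    using shift_path[OF adm[OF that], of "real i"] by (simp_all add: add.commute)
  show "lift_length len \<omega> k real n (\<lambda>i j s. \<gamma> i j (s - real i))
      = (\<Sum>i<k. piece_length (n i) (\<gamma> i))"
    unfolding lift_length_def piece_length_def using shifted(2)
    by (intro sum.cong refl arg_cong2[of _ _ _ _ "(*)"]) auto
  show "admissible_lift adm 0 (real k) (valley_path Y k n \<gamma>) k real n (\<lambda>i j s. \<gamma> i j (s - real i))"
    unfolding admissible_lift_def ran_lift_def
  proof (intro conjI allI impI ballI)
    show "subdivision 0 (real k) k real" unfolding subdivision_def by simp
    fix i assume i: "i < k"
    show "1 \<le> n i" using v i unfolding valley_def piece_def by auto
    show "(\<lambda>j. \<gamma> i j (s - real i)) ` {..<n i} = valley_path Y k n \<gamma> s"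
      if "s \<in> {real i..real (Suc i)}" for s
      using valley_path_piece[OF v i that] by simp
    fix j assume "j < n i"
    note sh = shifted(1)[OF i this]
    show "adm (real i) (real (Suc i)) (\<lambda>s. \<gamma> i j (s - real i))" by (rule sh)
    show "continuous_on {real i..real (Suc i)} (\<lambda>s. \<gamma> i j (s - real i))"
      using admissible_path[OF sh] by blast
  qed
qed

lemma valley_path_MBS:
  assumes v: "valley X Y k m Z n \<gamma>" and X: "X \<in> Ran"
  shows "MBS_path adm \<omega> 0 (real k) (valley_path Y k n \<gamma>)"
proof -
  let ?\<Gamma> = "valley_path Y k n \<gamma>" and ?c = "\<lambda>t. card (valley_path Y k n \<gamma> t)"
  have m: "m \<le> k" "Z 0 = X" using v unfolding valley_def by auto
  have at: "?c (real i) = card (Z i)" if "i \<le> k" for i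
    using valley_path_nat[OF v that] by simp
  have start: "?\<Gamma> 0 \<in> Ran" using valley_path_nat[OF v, of 0] m X by simp
  note lift = valley_path_lift(1)[OF v]
  have "ran_lift 0 (real k) ?\<Gamma> k real n (\<lambda>i j s. \<gamma> i j (s - real i))"
    using lift unfolding admissible_lift_def by (rule conjunct1)
  then have "ran_path \<omega> 0 (real k) ?\<Gamma>" using start by (rule ran_path_of_lift)
  then have "admissible_ran_path adm \<omega> 0 (real k) ?\<Gamma>"
    unfolding admissible_ran_path_def using lift by blast
  moreover have "?c constant_on {real i<..<real (Suc i)}" if "i < k" for i
    unfolding constant_on_def using valley_card(1)[OF v that] by blast
  ultimately have "crenelated adm \<omega> 0 (real k) ?\<Gamma>"
    unfolding crenelated_def by (intro conjI exI[of _ k] exI[of _ real]) (auto simp: subdivision_def)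
  moreover have "antimono_on {0..real m} ?c"
  proof -
    have "monotone_on {real 0..real m} (\<le>) (\<ge>) ?c"
    proof (rule monotone_on_unit_pieces)
      fix i assume "i < m"
      then have i: "i < k" "card (Z i) = n i" using m v unfolding valley_def by auto
      show "antimono_on {real i..real (Suc i)} ?c"
      proof (rule monotone_onI)
        fix s t assume st: "s \<in> {real i..real (Suc i)}" "t \<in> {real i..real (Suc i)}" "s \<le> t"
        have full: "?c r = n i" if "r \<in> {real i..<real (Suc i)}" for r
          using valley_card(1)[OF v i(1), of r] at[of i] i that by (cases "r = real i") auto
        have "?c r \<le> n i" if "r \<in> {real i..real (Suc i)}" for r
          using full[of r] at[of "Suc i"] valley_card(3)[OF v i(1)] i that
          by (cases "r = real (Suc i)") auto
        then show "?c s \<ge> ?c t"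
          using full[of s] st by (cases "s = real (Suc i)") (auto dest: antisym)
      qed
    qed (auto simp: transp_def reflp_def)
    then show ?thesis by simp
  qed
  moreover have "mono_on {real m..real k} ?c"
  proof (rule monotone_on_unit_pieces)
    fix i assume "m \<le> i" "i < k"
    then have i: "i < k" "card (Z (Suc i)) = n i" using v unfolding valley_def by auto
    show "mono_on {real i..real (Suc i)} ?c"
    proof (rule monotone_onI)
      fix s t assume st: "s \<in> {real i..real (Suc i)}" "t \<in> {real i..real (Suc i)}" "s \<le> t"
      have full: "?c r = n i" if "r \<in> {real i<..real (Suc i)}" for r
        using valley_card(1)[OF v i(1), of r] at[of "Suc i"] i that by (cases "r = real (Suc i)") auto
      have "?c r \<le> n i" if "r \<in> {real i..real (Suc i)}" for r
        using full[of r] at[of i] valley_card(2)[OF v i(1)] i that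
        by (cases "r = real i") auto
      then show "?c s \<le> ?c t"
        using full[of t] st by (cases "t = real i") (auto dest: antisym)
    qed
  qed (use m in \<open>auto simp: transp_def reflp_def\<close>)
  ultimately show ?thesis
    unfolding MBS_path_def using m by (intro conjI bexI[of _ "real m"]) auto
qed

end

theorem theorem3p21:
  fixes adm :: "real \<Rightarrow> real \<Rightarrow> (real \<Rightarrow> 'a::metric_space) \<Rightarrow> bool"
    and len :: "real \<Rightarrow> real \<Rightarrow> (real \<Rightarrow> 'a) \<Rightarrow> real"
    and \<omega> :: "nat \<Rightarrow> real"
    and X Y :: "'a set"
  assumes length_space: "length_space adm len"
    and heine_borel: "\<And>S :: 'a set. closed S \<Longrightarrow> bounded S \<Longrightarrow> compact S"
    and geodesic: "\<And>x y :: 'a. \<exists>a b \<gamma>. adm a b \<gamma> \<and> \<gamma> a = x \<and> \<gamma> b = y \<and> len a b \<gamma> = dist x y"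
    and X: "X \<in> Ran"
    and Y: "Y \<in> Ran"
    and weight: "weight \<omega>"
  shows "\<exists>a b \<Gamma>. MBS_path adm \<omega> a b \<Gamma> \<and> \<Gamma> a = X \<and> \<Gamma> b = Y
    \<and> ran_length adm len \<omega> a b \<Gamma> = ran_dist \<omega> X Y"
proof -
  interpret weighted_length_space adm len \<omega>
    using length_space weight by (intro weighted_length_space.intro weighted.intro)
  have "joined X Y (ran_dist \<omega> X Y)"
    by (rule joined_optimally[OF _ geodesic X Y]) (rule heine_borel)
  then obtain k m Z n \<gamma> where v: "valley X Y k m Z n \<gamma>"
    and le: "(\<Sum>i<k. piece_length (n i) (\<gamma> i)) \<le> ran_dist \<omega> X Y"
    unfolding joined_def by blast
  let ?\<Gamma> = "valley_path Y k n \<gamma>"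
  have ends: "?\<Gamma> 0 = X" "?\<Gamma> (real k) = Y"
    using valley_path_nat[OF v, of 0] valley_path_nat[OF v, of k] v unfolding valley_def by auto
  have "ran_length adm len \<omega> 0 (real k) ?\<Gamma> = ran_dist \<omega> X Y"
    using ran_length_eq_ran_dist[OF valley_path_lift(1)[OF v]] valley_path_lift(2)[OF v] le X
    unfolding ends by simp
  then show ?thesis
    using valley_path_MBS[OF v X] ends by blast
qed

end
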